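(* Suppose Assumptions (A1)–(A4) hold. Let $\kappa_2,\alpha,\beta,\eta$ and $\tilde\epsilon_1,\tilde\epsilon_2,\epsilon_3,\epsilon_4,\epsilon_8,\epsilon_{11},\epsilon_{12}$ be exactly as in Theorem 3, let $\hat\epsilon\in(0,1)$ and $\breve\epsilon\in(\hat\epsilon,1)$, and let $\delta_{i,k}\in(0,\hat\epsilon^{k/2}]$ for all $i,k$. Define $\epsilon_9=\min\{\frac1{2\rho(L)},\frac{\alpha-\beta}{2\alpha}\}$, $\tilde\epsilon_{10}=\eta\min\{\tilde\epsilon_1-\eta\tilde\epsilon_2,\ \epsilon_3-\eta\epsilon_4,\ \frac\nu4\}$, $\tilde\epsilon=\tilde\epsilon_{10}/\epsilon_8$, and for $k\in\mathbb N_0$ $$\phi_k=\Big(\frac{\epsilon_{11}}{1-\tilde\epsilon}+\epsilon_{12}\Big)\cdot\begin{cases}\frac{(1-\tilde\epsilon)^{k+1}}{1-\tilde\epsilon-\hat\epsilon},&1-\tilde\epsilon>\hat\epsilon,\\ \frac{\hat\epsilon^{k+1}}{\hat\epsilon+\tilde\epsilon-1},&1-\tilde\epsilon<\hat\epsilon,\\ \frac{\breve\epsilon^{k+1}}{\breve\epsilon-\hat\epsilon},&1-\tilde\epsilon=\hat\epsilon.\end{cases}$$ Let $\{\boldsymbol x_k\}$ be generated by Algorithm 2. Then for all $k\in\mathbb N_0$, $$\|\boldsymbol x_k-\bar{\boldsymbol x}_k\|^2+n(f(\bar x_k)-f^* )\le\frac1{\epsilon_9}\big((1-\tilde\epsilon)^{k+1}\epsilon_8\hat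 U_0+\phi_k\big).$$ Moreover, if the projection $\mathcal P_{\mathbb X^*}(x)=\arg\min_{y\in\mathbb X^*}\|x-y\|^2$ is well defined for all $x$, then for all $k\in\mathbb N_0$, $$\|\boldsymbol x_k-\mathbf 1_n\otimes\mathcal P_{\mathbb X^*}(\bar x_k)\|^2\le\frac1{\epsilon_9}\Big(1+\frac1{2\nu}\Big)\big((1-\tilde\epsilon)^{k+1}\epsilon_8\hat U_0+\phi_k\big).$$
   Context: Setting as in Theorem 3: graph Laplacian $L$ ($\rho(L)$ largest, $\rho_2(L)$ smallest positive eigenvalue), $f=\frac1n\sum_if_i$, $\mathbb X^*=\arg\min f$, $f^*=\min f$. Assumptions: (A1) $\mathcal G$ connected; (A2) $\mathbb X^*\ne\emptyset$, $f^*>-\infty$; (A3) each $\nabla f_i$ is $L_f$-Lipschitz; (A4) $\frac12\|\nabla f(x)\|^2\ge\nu(f(x)-f^* )$ for all $x$ (Polyak–Łojasiewicz, $\nu>0$). Constants from Theorem 3: $\kappa_2>1$, $\kappa_3=\frac14(1+(1+8\kappa_2+\frac8{\rho_2(L)})^{1/2})$, $\tilde\kappa_1=\frac{2+9L_f^2}{2\rho_2(L)}$, $\tilde\kappa_4=6(\kappa_2+\frac1{\rho_2(L)})L_f^2+2(9(\kappa_2+\frac1{\rho_2(L)})^2L_f^4+3L_f^2)^{1/2}$; $\beta>\max\{\frac{\tilde\kappa_1}{\kappa_2-1},\kappa_3,\tilde\kappa_4\}$, $\alpha\in(\beta+\tilde\kappa_1,\kappa_2\beta]$; $\tilde\epsilon_1=(\alpha-\beta)\rho_2(L)-\frac12(2+9L_f^2)$,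 $\tilde\epsilon_2=\beta^2\rho(L)+(2\alpha^2+\beta^2)\rho^2(L)+\frac{15}2L_f^2$, $\epsilon_3=\beta-\frac12-\frac\alpha{2\beta^2}-\frac1{2\beta\rho_2(L)}$, $\epsilon_4=2\beta^2+\frac12$, $\tilde\epsilon_5=\frac18-\frac3{2\beta}(\frac1\beta+\frac1{\rho_2(L)}+\frac\alpha\beta)L_f^2$, $\tilde\epsilon_6=\frac3{\beta^2}(1+\frac1{\rho_2(L)}+\frac\alpha\beta)L_f^2+\frac{L_f(1+3L_f)}2$; $\eta\in(0,\min\{\tilde\epsilon_1/\tilde\epsilon_2,\epsilon_3/\epsilon_4,\tilde\epsilon_5/\tilde\epsilon_6\})$; $\epsilon_8=\frac{\alpha+\beta}{2\beta}+\frac1{2\rho_2(L)}$; $\epsilon_{12}=((\frac1{\beta^2}+\frac1{2\eta\beta})(\frac1{\rho_2(L)}+\frac\alpha\beta)+\frac1{2\eta\beta^2}+\frac1{\beta^2}+\frac12)\frac{3npL_f^2}4$, $\epsilon_{11}=(\frac{15\eta}4+5\eta^2)\frac{3npL_f^2}4+\epsilon_{12}$. Gradient estimator $\hat\nabla h(x,\delta)=\frac1\delta\sum_{l=1}^p(h(x+\delta e_l)-h(x))e_l$. Algorithm 2: $x_{i,0}$ arbitrary, $\sum_jv_{j,0}=\mathbf 0_p$, $x_{i,k+1}=x_{i,k}-\eta(\alpha\sum_jL_{ij}x_{j,k}+\beta v_{i,k}+\hat\nabla f_i(x_{i,k},\delta_{i,k}))$, $v_{i,k+1}=v_{i,k}+\eta\beta\sum_jL_{ij}x_{j,k}$.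 Notation: $\boldsymbol x_k=\mathrm{col}(x_{i,k})$, $\boldsymbol v_k=\mathrm{col}(v_{i,k})$, $\bar x_k=\frac1n\sum_ix_{i,k}$, $\bar{\boldsymbol x}_k=\mathbf 1_n\otimes\bar x_k$, $\boldsymbol K=(I_n-\frac1n\mathbf 1\mathbf 1^\top)\otimes I_p$, $\|z\|^2_M=z^\top Mz$, $\delta_0=\max_i\delta_{i,0}$, $\boldsymbol h^0_0=\mathrm{col}(\hat\nabla f_1(\bar x_0,\delta_0),\dots,\hat\nabla f_n(\bar x_0,\delta_0))$, $\hat U_0=\|\boldsymbol x_0\|^2_{\boldsymbol K}+\|\boldsymbol v_0+\frac1\beta\boldsymbol h^0_0\|^2_{\boldsymbol K}+n(f(\bar x_0)-f^* )$. *)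

theory Defs
  imports "HOL-Analysis.Analysis"
begin

section \<open>Graph Laplacian and its spectrum\<close>

text \<open>Undirected weighted graph on the finite vertex type 'n, given by a weighted
adjacency matrix A (symmetric, nonnegative, zero diagonal). Its Laplacian is L = D - A.\<close>

definition weighted_adjacency :: "real^'n^'n \<Rightarrow> bool" where
  "weighted_adjacency A \<longleftrightarrow>
     (\<forall>i j. A$i$j = A$j$i) \<and> (\<forall>i j. 0 \<le> A$i$j) \<and> (\<forall>i. A$i$i = 0)"

definition laplacian :: "real^'n^'n \<Rightarrow> real^'n^'n" where
  "laplacian A = (\<chi> i j. if i = j then (\<Sum>k\<in>UNIV. A$i$k) else - A$i$j)"

definition graph_connected :: "real^'n^'n \<Rightarrow> bool" where
  "graph_connected A \<longleftrightarrow> (\<forall>i j. (i, j) \<in> {(a, b). 0 < A$a$b}\<^sup>*)"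

definition mat_eigenvalues :: "real^'n^'n \<Rightarrow> real set" where
  "mat_eigenvalues M = {c. \<exists>v. v \<noteq> 0 \<and> M *v v = c *\<^sub>R v}"

text \<open>\<rho>(L): largest eigenvalue; \<rho>_2(L): smallest positive eigenvalue.\<close>
definition rho :: "real^'n^'n \<Rightarrow> real" where
  "rho M = Max (mat_eigenvalues M)"

definition rho2 :: "real^'n^'n \<Rightarrow> real" where
  "rho2 M = Min {c \<in> mat_eigenvalues M. 0 < c}"

section \<open>Zeroth-order gradient estimator\<close>

text \<open>For 'a a Euclidean space of dimension p, Basis is the standard basis e_1..e_p.\<close>
definition grad_est :: "('a::euclidean_space \<Rightarrow> real) \<Rightarrow> 'a \<Rightarrow> real \<Rightarrow> 'a" where
  "grad_est h x \<delta> = (\<Sum>l\<in>Basis. ((h (x + \<delta> *\<^sub>R l) - h x) / \<delta>) *\<^sub>R l)"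

section \<open>Averages and K-norm of stacked vectors\<close>

definition avg :: "('n::finite \<Rightarrow> 'a::real_vector) \<Rightarrow> 'a" where
  "avg z = (1 / real CARD('n)) *\<^sub>R (\<Sum>i\<in>UNIV. z i)"

text \<open>\<parallel>z\<parallel>^2_K with K = (I_n - 1 1^T / n) \<otimes> I_p, i.e. \<Sum>_i \<parallel>z_i - avg z\<parallel>^2.\<close>
definition Knorm2 :: "('n::finite \<Rightarrow> 'a::real_inner) \<Rightarrow> real" where
  "Knorm2 z = (\<Sum>i\<in>UNIV. (norm (z i - avg z))\<^sup>2)"

section \<open>Constants of Theorem 3 (r = \<rho>(L), r2 = \<rho>_2(L))\<close>

definition kappa3 :: "real \<Rightarrow> real \<Rightarrow> real" where
  "kappa3 k2 r2 = (1 + sqrt (1 + 8 * k2 + 8 / r2)) / 4"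

definition kappa1t :: "real \<Rightarrow> real \<Rightarrow> real" where
  "kappa1t Lf r2 = (2 + 9 * Lf\<^sup>2) / (2 * r2)"

definition kappa4t :: "real \<Rightarrow> real \<Rightarrow> real \<Rightarrow> real" where
  "kappa4t Lf k2 r2 = 6 * (k2 + 1 / r2) * Lf\<^sup>2
      + 2 * sqrt (9 * (k2 + 1 / r2)\<^sup>2 * Lf ^ 4 + 3 * Lf\<^sup>2)"

definition eps1t :: "real \<Rightarrow> real \<Rightarrow> real \<Rightarrow> real \<Rightarrow> real" where
  "eps1t \<alpha> \<beta> Lf r2 = (\<alpha> - \<beta>) * r2 - (2 + 9 * Lf\<^sup>2) / 2"

definition eps2t :: "real \<Rightarrow> real \<Rightarrow> real \<Rightarrow> real \<Rightarrow> real" where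
  "eps2t \<alpha> \<beta> Lf r = \<beta>\<^sup>2 * r + (2 * \<alpha>\<^sup>2 + \<beta>\<^sup>2) * r\<^sup>2 + 15 / 2 * Lf\<^sup>2"

definition eps3 :: "real \<Rightarrow> real \<Rightarrow> real \<Rightarrow> real" where
  "eps3 \<alpha> \<beta> r2 = \<beta> - 1 / 2 - \<alpha> / (2 * \<beta>\<^sup>2) - 1 / (2 * \<beta> * r2)"

definition eps4 :: "real \<Rightarrow> real" where
  "eps4 \<beta> = 2 * \<beta>\<^sup>2 + 1 / 2"

definition eps5t :: "real \<Rightarrow> real \<Rightarrow> real \<Rightarrow> real \<Rightarrow> real" where
  "eps5t \<alpha> \<beta> Lf r2 = 1 / 8 - 3 / (2 * \<beta>) * (1 / \<beta> + 1 / r2 + \<alpha> / \<beta>) * Lf\<^sup>2"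

definition eps6t :: "real \<Rightarrow> real \<Rightarrow> real \<Rightarrow> real \<Rightarrow> real" where
  "eps6t \<alpha> \<beta> Lf r2 = 3 / \<beta>\<^sup>2 * (1 + 1 / r2 + \<alpha> / \<beta>) * Lf\<^sup>2 + Lf * (1 + 3 * Lf) / 2"

definition eps8 :: "real \<Rightarrow> real \<Rightarrow> real \<Rightarrow> real" where
  "eps8 \<alpha> \<beta> r2 = (\<alpha> + \<beta>) / (2 * \<beta>) + 1 / (2 * r2)"

definition eps12 :: "real \<Rightarrow> real \<Rightarrow> real \<Rightarrow> real \<Rightarrow> real \<Rightarrow> real \<Rightarrow> real \<Rightarrow> real" where
  "eps12 \<alpha> \<beta> \<eta> Lf r2 n p =
     ((1 / \<beta>\<^sup>2 + 1 / (2 * \<eta> * \<beta>)) * (1 / r2 + \<alpha> / \<beta>) + 1 / (2 * \<eta> * \<beta>\<^sup>2)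
       + 1 / \<beta>\<^sup>2 + 1 / 2) * (3 * n * p * Lf\<^sup>2 / 4)"

definition eps11 :: "real \<Rightarrow> real \<Rightarrow> real \<Rightarrow> real \<Rightarrow> real \<Rightarrow> real \<Rightarrow> real \<Rightarrow> real" where
  "eps11 \<alpha> \<beta> \<eta> Lf r2 n p =
     (15 * \<eta> / 4 + 5 * \<eta>\<^sup>2) * (3 * n * p * Lf\<^sup>2 / 4) + eps12 \<alpha> \<beta> \<eta> Lf r2 n p"

section \<open>Constants of Theorem 4\<close>

definition eps9 :: "real \<Rightarrow> real \<Rightarrow> real \<Rightarrow> real" where
  "eps9 \<alpha> \<beta> r = min (1 / (2 * r)) ((\<alpha> - \<beta>) / (2 * \<alpha>))"

definition eps10t :: "real \<Rightarrow> real \<Rightarrow> real \<Rightarrow> real \<Rightarrow> real \<Rightarrow> real \<Rightarrow> real \<Rightarrow> real" where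
  "eps10t \<alpha> \<beta> \<eta> Lf r r2 \<nu> =
     \<eta> * min (min (eps1t \<alpha> \<beta> Lf r2 - \<eta> * eps2t \<alpha> \<beta> Lf r)
                  (eps3 \<alpha> \<beta> r2 - \<eta> * eps4 \<beta>)) (\<nu> / 4)"

text \<open>phi_k, with et = \<epsilon>~, eh = \<epsilon>^, eb = \<epsilon>\<breve>.\<close>
definition phi :: "real \<Rightarrow> real \<Rightarrow> real \<Rightarrow> real \<Rightarrow> real \<Rightarrow> nat \<Rightarrow> real" where
  "phi e11 e12 et eh eb k = (e11 / (1 - et) + e12) *
     (if 1 - et > eh then (1 - et) ^ (k + 1) / (1 - et - eh)
      else if 1 - et < eh then eh ^ (k + 1) / (eh + et - 1)
      else eb ^ (k + 1) / (eb - eh))"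

section \<open>Projection onto the solution set\<close>

definition is_proj :: "'a::real_normed_vector set \<Rightarrow> 'a \<Rightarrow> 'a \<Rightarrow> bool" where
  "is_proj S x y \<longleftrightarrow> y \<in> S \<and> (\<forall>z\<in>S. (norm (x - y))\<^sup>2 \<le> (norm (x - z))\<^sup>2)"

definition proj :: "'a::real_normed_vector set \<Rightarrow> 'a \<Rightarrow> 'a" where
  "proj S x = (THE y. is_proj S x y)"

end

theory Submission
  imports Defs
begin

text \<open>Expanding in an orthonormal eigenbasis of the Laplacian on the vectors with zero sum turns the
  consensus part of the algorithm into decoupled scalar recursions, and the quadratic part of the
  Lyapunov function into a sum of binary quadratic forms in the coordinates of \<open>x\<close> and of
  \<open>v + h0 / \<beta>\<close>. Adding \<open>\<theta> n (F - fstar)\<close> with \<open>1 \<le> \<theta> \<le> 2\<close> gives a function \<open>V\<close> with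
  \<open>V (Suc k) \<le> (1 - et) V k + e11 eh ^ k + e12 eh ^ Suc k\<close>. This only yields the exponent \<open>k\<close>; the
  extra factor \<open>1 - et\<close> in the claim comes from slack in the constant \<open>e9\<close>. For the distance to the
  minimisers, the Polyak--Lojasiewicz condition gives quadratic growth of \<open>F\<close> with constant
  \<open>\<nu> / 2\<close>.\<close>

section \<open>Spectral theorem for self-adjoint maps\<close>

text \<open>The shift of \<open>v\<close> by \<open>h0 / \<beta>\<close> measures the distance to an
  equilibrium: once the agents agree, the mean-free part of the primal update is
  \<open>- \<eta>\<close> times that of \<open>\<beta> v + h\<close>. Since \<open>h0\<close> is
  evaluated at the average iterate, it drifts only through the step of the average and the estimator
  error, and the descent of \<open>F\<close> supplies the squared step of the average with a
  negative sign to pay for this. The delicate point is the constants. Completing the square bounds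
  the energy below by \<open>(1 - 1 / (1 / r + \<alpha> / \<beta>)) / 2\<close> times the consensus
  error. The step size bounds keep \<open>et\<close> so small that this constant stays above
  \<open>e9\<close> even after multiplication by \<open>1 - et\<close>; this comparison involves
  only \<open>\<alpha> / \<beta>\<close> and \<open>1 / r\<close>.\<close>

lemma selfadjoint_maximizer_eigenvector:
  fixes T :: "'a::euclidean_space \<Rightarrow> 'a"
  assumes T: "linear T" and sa: "\<And>x y. T x \<bullet> y = x \<bullet> T y"
    and S: "subspace S" "\<And>x. x \<in> S \<Longrightarrow> T x \<in> S" and b: "b \<in> S" "norm b = 1"
    and max: "\<And>x. x \<in> S \<Longrightarrow> norm x = 1 \<Longrightarrow> x \<bullet> T x \<le> b \<bullet> T b"
  shows "T b = (b \<bullet> T b) *\<^sub>R b"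
proof -
  define \<mu> where "\<mu> = b \<bullet> T b"
  define h where "h = T b - \<mu> *\<^sub>R b"
  \<comment> \<open>\<open>h\<close> is half the gradient of the Rayleigh quotient at
    \<open>b\<close>. Moving by \<open>t *\<^sub>R h\<close> gains \<open>2 * t\<close> times the
    squared norm of \<open>h\<close> and loses at most \<open>t^2 * C\<close>; the choice of
    \<open>t\<close> lets the gain win unless \<open>h = 0\<close>. The added 1 keeps
    \<open>C\<close> positive. By homogeneity the bound \<open>q\<close> holds on all of
    \<open>S\<close>, so the perturbed vector need not be normalised.\<close>
  define C where "C = \<bar>h \<bullet> T h - \<mu> * (h \<bullet> h)\<bar> + 1"
  define t where "t = (h \<bullet> h) / C"
  have C: "C > 0" unfolding C_def by simp
  have hS: "h \<in> S" unfolding h_def using S b by (simp add: subspace_diff subspace_scale)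
  have bb: "b \<bullet> b = 1" using b by (simp add: dot_square_norm)
  have q: "x \<bullet> T x \<le> \<mu> * (x \<bullet> x)" if "x \<in> S" for x
  proof (cases "x = 0")
    case False
    have "sgn x \<bullet> T (sgn x) \<le> \<mu>"
      using max[of "sgn x"] that S False by (simp add: \<mu>_def sgn_div_norm subspace_scale)
    moreover have "sgn x \<bullet> T (sgn x) = (x \<bullet> T x) / (norm x)\<^sup>2"
      by (simp add: sgn_div_norm linear_scale[OF T] power2_eq_square field_simps)
    ultimately show ?thesis using False by (simp add: field_simps dot_square_norm)
  qed (simp add: linear_0[OF T])
  have "(b + t *\<^sub>R h) \<bullet> T (b + t *\<^sub>R h) \<le> \<mu> * ((b + t *\<^sub>R h) \<bullet> (b + t *\<^sub>R h))"
    by (rule q) (use S b hS in \<open>simp add: subspace_add subspace_scale\<close>)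
  hence "2 * t * (h \<bullet> T b - \<mu> * (h \<bullet> b)) + t\<^sup>2 * (h \<bullet> T h - \<mu> * (h \<bullet> h)) \<le> 0"
    by (simp add: linear_add[OF T] linear_scale[OF T] inner_add_left inner_add_right bb \<mu>_def[symmetric]
        sa[of b h, symmetric] inner_commute[of "T b" h] inner_commute[of b h] power2_eq_square algebra_simps)
  moreover have "h \<bullet> T b - \<mu> * (h \<bullet> b) = h \<bullet> h"
    by (simp add: h_def inner_diff_right inner_diff_left)
  moreover have "t\<^sup>2 * (h \<bullet> T h - \<mu> * (h \<bullet> h)) \<ge> t\<^sup>2 * (- C)"
    by (rule mult_left_mono) (auto simp: C_def)
  ultimately have "2 * t * (h \<bullet> h) \<le> t\<^sup>2 * C" by simp
  hence "2 * (h \<bullet> h)\<^sup>2 / C \<le> (h \<bullet> h)\<^sup>2 / C"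
    using C by (simp add: t_def power2_eq_square)
  hence "2 * (h \<bullet> h)\<^sup>2 \<le> (h \<bullet> h)\<^sup>2" using C by (simp add: divide_le_cancel)
  hence "h = 0" by simp
  thus ?thesis by (simp add: h_def \<mu>_def)
qed

text \<open>A maximiser of the quadratic form on the unit sphere of \<open>S\<close> is an
  eigenvector, and self-adjointness makes its orthogonal complement in \<open>S\<close> invariant
  again. Working with an arbitrary invariant subspace serves both the induction on the dimension and
  the later use on zero-sum vectors.\<close>

lemma selfadjoint_eigenbasis:
  fixes T :: "'a::euclidean_space \<Rightarrow> 'a"
  assumes T: "linear T" and sa: "\<And>x y. T x \<bullet> y = x \<bullet> T y"
    and "subspace S" "\<And>x. x \<in> S \<Longrightarrow> T x \<in> S"
  shows "\<exists>B. B \<subseteq> S \<and> pairwise orthogonal B \<and> (\<forall>b\<in>B. norm b = 1 \<and> (\<exists>c. T b = c *\<^sub>R b)) \<and> span B = S"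
  using assms(3,4)
proof (induction "dim S" arbitrary: S rule: less_induct)
  case less
  note S = less.prems
  show ?case
  proof (cases "S = {0}")
    case True
    thus ?thesis by (intro exI[of _ "{}"]) auto
  next
    case False
    then obtain z where z: "z \<in> S" "z \<noteq> 0" using S(1) subspace_0 by blast
    let ?U = "S \<inter> sphere 0 1"
    have "compact ?U"
      using closed_subspace[OF S(1)] by (simp add: closed_Int_compact)
    moreover have "sgn z \<in> ?U" using z S by (simp add: norm_sgn sgn_div_norm subspace_scale)
    moreover have "continuous_on ?U (\<lambda>x. x \<bullet> T x)"
      using T by (intro continuous_intros linear_continuous_on) (simp add: linear_conv_bounded_linear)
    ultimately obtain b where b: "b \<in> ?U" "\<And>x. x \<in> ?U \<Longrightarrow> x \<bullet> T x \<le> b \<bullet> T b"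
      using continuous_attains_sup[of ?U "\<lambda>x. x \<bullet> T x"] by blast
    have eig: "T b = (b \<bullet> T b) *\<^sub>R b"
      using b by (intro selfadjoint_maximizer_eigenvector[OF T sa S]) auto
    have b1: "b \<in> S" "norm b = 1" using b by auto
    hence bb: "b \<bullet> b = 1" by (simp add: dot_square_norm)
    define S' where "S' = {x \<in> S. b \<bullet> x = 0}"
    have S'1: "subspace S'"
      unfolding S'_def using S(1) by (auto simp: subspace_def inner_add_right)
    have S'2: "T x \<in> S'" if "x \<in> S'" for x
    proof -
      have "b \<bullet> T x = (b \<bullet> T b) * (b \<bullet> x)" by (metis eig inner_scaleR_left sa)
      thus ?thesis using that S by (simp add: S'_def)
    qed
    have "b \<notin> S'" by (simp add: S'_def bb)
    moreover have "S' \<subseteq> S" by (auto simp: S'_def)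
    ultimately have "S' \<subset> S" using b1 by blast
    hence "dim S' < dim S"
      by (metis S'1 S(1) dim_psubset span_eq_iff)
    from less.hyps[OF this S'1 S'2] obtain B where B: "B \<subseteq> S'" "pairwise orthogonal B"
      "\<And>b. b \<in> B \<Longrightarrow> norm b = 1 \<and> (\<exists>c. T b = c *\<^sub>R b)" "span B = S'" by blast
    have "x \<in> span (insert b B)" if "x \<in> S" for x
    proof -
      have "x - (b \<bullet> x) *\<^sub>R b \<in> S'"
        using that b1 S by (simp add: S'_def subspace_diff subspace_scale inner_diff_right bb)
      hence "x - (b \<bullet> x) *\<^sub>R b \<in> span (insert b B)" using B(4) span_mono[of B "insert b B"] by blast
      moreover have "(b \<bullet> x) *\<^sub>R b \<in> span (insert b B)" by (simp add: span_base span_scale)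
      ultimately show ?thesis using span_add by fastforce
    qed
    moreover have "span (insert b B) \<subseteq> S"
      using B(1) b1 S(1) by (intro span_minimal) (auto simp: S'_def)
    ultimately have "span (insert b B) = S" by blast
    moreover have "pairwise orthogonal (insert b B)"
      using B(1,2) by (auto simp: pairwise_insert orthogonal_def S'_def inner_commute)
    ultimately show ?thesis
      using B b1 eig by (intro exI[of _ "insert b B"]) (auto simp: S'_def)
  qed
qed

lemma orthonormal_Parseval:
  fixes u :: "'a::euclidean_space"
  assumes B: "pairwise orthogonal B" "\<And>b. b \<in> B \<Longrightarrow> norm b = 1" and u: "u \<in> span B"
  shows "(\<Sum>b\<in>B. (b \<bullet> u)\<^sup>2) = (norm u)\<^sup>2"
proof -
  have fin: "finite B"
    using pairwise_orthogonal_independent[OF B(1)] B(2) independent_bound by fastforce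
  from u obtain a where a: "u = (\<Sum>b\<in>B. a b *\<^sub>R b)" unfolding span_finite[OF fin] by auto
  have bu: "b \<bullet> u = a b" if "b \<in> B" for b
  proof -
    have "b \<bullet> u = (\<Sum>b'\<in>B. if b' = b then a b else 0)" unfolding a inner_sum_right
      by (rule sum.cong) (use B that in \<open>auto simp: pairwise_def orthogonal_def dot_square_norm\<close>)
    thus ?thesis using fin that by simp
  qed
  have "(norm u)\<^sup>2 = u \<bullet> u" by (simp add: dot_square_norm)
  also have "\<dots> = (\<Sum>b\<in>B. a b * (b \<bullet> u))" by (subst (1) a) (simp add: inner_sum_left)
  also have "\<dots> = (\<Sum>b\<in>B. (b \<bullet> u)\<^sup>2)" by (rule sum.cong) (auto simp: bu power2_eq_square)
  finally show ?thesis ..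
qed

section \<open>Eigenbasis of the graph Laplacian\<close>

lemma laplacian_mult_component:
  assumes "weighted_adjacency A"
  shows "(laplacian A *v u) $ i = (\<Sum>j\<in>UNIV. A$i$j * (u$i - u$j))"
proof -
  have "(laplacian A *v u) $ i
      = (\<Sum>j\<in>UNIV. (if j = i then (\<Sum>k\<in>UNIV. A$i$k) * u$i else 0) - A$i$j * u$j)"
    unfolding laplacian_def matrix_vector_mult_def
    using assms by (auto simp: weighted_adjacency_def intro!: sum.cong)
  thus ?thesis by (simp add: sum_subtractf sum_distrib_right right_diff_distrib)
qed

lemma laplacian_sym: "weighted_adjacency A \<Longrightarrow> laplacian A $ i $ j = laplacian A $ j $ i"
  by (auto simp: weighted_adjacency_def laplacian_def)

lemma laplacian_selfadjoint:
  assumes "weighted_adjacency A"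
  shows "(laplacian A *v u) \<bullet> w = u \<bullet> (laplacian A *v w)"
proof -
  have "transpose (laplacian A) = laplacian A"
    by (simp add: transpose_def vec_eq_iff laplacian_sym[OF assms])
  thus ?thesis by (metis dot_lmul_matrix inner_commute transpose_matrix_vector)
qed

lemma laplacian_sum_zero:
  assumes "weighted_adjacency A"
  shows "(\<Sum>i\<in>UNIV. laplacian A $ i $ j) = 0"
proof -
  have "(\<Sum>i\<in>UNIV. laplacian A $ i $ j) = (laplacian A *v 1) $ j"
    by (simp add: matrix_vector_mult_def laplacian_sym[OF assms, of _ j])
  thus ?thesis by (simp add: laplacian_mult_component[OF assms])
qed

text \<open>Averaging the double sum with its index-swapped copy turns
  \<open>u_i (u_i - u_j)\<close> into half a square.\<close>

lemma laplacian_quadratic_form: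
  assumes "weighted_adjacency A"
  shows "u \<bullet> (laplacian A *v u) = (\<Sum>i\<in>UNIV. \<Sum>j\<in>UNIV. A$i$j * (u$i - u$j)\<^sup>2) / 2"
proof -
  let ?s = "\<Sum>i\<in>UNIV. \<Sum>j\<in>UNIV. A$i$j * u$i * (u$i - u$j)"
  have 1: "u \<bullet> (laplacian A *v u) = ?s"
    by (simp add: inner_vec_def laplacian_mult_component[OF assms] sum_distrib_left ac_simps)
  have "?s = (\<Sum>i\<in>UNIV. \<Sum>j\<in>UNIV. A$j$i * u$j * (u$j - u$i))" by (rule sum.swap)
  also have "\<dots> = (\<Sum>i\<in>UNIV. \<Sum>j\<in>UNIV. A$i$j * u$j * (u$j - u$i))"
    using assms by (simp add: weighted_adjacency_def)
  finally have "2 * ?s = ?s + (\<Sum>i\<in>UNIV. \<Sum>j\<in>UNIV. A$i$j * u$j * (u$j - u$i))" by simp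
  also have "\<dots> = (\<Sum>i\<in>UNIV. \<Sum>j\<in>UNIV. A$i$j * (u$i - u$j)\<^sup>2)"
    by (simp add: sum.distrib[symmetric] power2_eq_square algebra_simps)
  finally show ?thesis using 1 by simp
qed

text \<open>If the form vanishes, \<open>u\<close> agrees across every edge of positive weight;
  connectedness makes it constant, and a constant with zero sum is zero.\<close>

lemma laplacian_form_pos:
  assumes adj: "weighted_adjacency A" and con: "graph_connected A"
    and u: "(\<Sum>i\<in>UNIV. u$i) = 0" "u \<noteq> 0"
  shows "u \<bullet> (laplacian A *v u) > 0"
proof -
  have nn: "A$i$j * (u$i - u$j)\<^sup>2 \<ge> 0" for i j using adj by (simp add: weighted_adjacency_def)
  hence "u \<bullet> (laplacian A *v u) \<ge> 0"
    by (simp add: laplacian_quadratic_form[OF adj] sum_nonneg)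
  moreover have "u \<bullet> (laplacian A *v u) \<noteq> 0"
  proof
    assume "u \<bullet> (laplacian A *v u) = 0"
    hence "(\<Sum>i\<in>UNIV. \<Sum>j\<in>UNIV. A$i$j * (u$i - u$j)\<^sup>2) = 0"
      by (simp add: laplacian_quadratic_form[OF adj])
    hence z: "A$i$j * (u$i - u$j)\<^sup>2 = 0" for i j
      using nn by (simp add: sum_nonneg_eq_0_iff sum_nonneg)
    have "u$i = u$j" for i j
    proof -
      have "(i, j) \<in> {(a, b). 0 < A$a$b}\<^sup>*" using con by (simp add: graph_connected_def)
      thus ?thesis
      proof (induction rule: rtrancl_induct)
        case (step j k)
        thus ?case using z[of j k] by auto
      qed simp
    qed
    then obtain c where c: "\<And>i. u$i = c" by blast
    with u(1) have "c = 0" by simp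
    with c u(2) show False by (simp add: vec_eq_iff)
  qed
  ultimately show ?thesis by simp
qed

text \<open>The point is the link with \<open>rho\<close> and \<open>rho2\<close>, a
  \<open>Max\<close> and a \<open>Min\<close> over sets given only by an eigenvector equation: every
  eigenvalue turns out to be 0 or some \<open>l b\<close>, so these sets are finite.\<close>

lemma laplacian_eigenbasis:
  fixes A :: "real^'n::finite^'n"
  assumes adj: "weighted_adjacency A" and con: "graph_connected A" and n2: "CARD('n) \<ge> 2"
  obtains B l where "finite B" "pairwise orthogonal B" "\<And>b. b \<in> B \<Longrightarrow> norm b = 1"
    "span B = {u. (\<Sum>i\<in>UNIV. u$i) = 0}"
    "\<And>b. b \<in> B \<Longrightarrow> laplacian A *v b = l b *\<^sub>R b"
    "\<And>b. b \<in> B \<Longrightarrow> rho2 (laplacian A) \<le> l b \<and> l b \<le> rho (laplacian A)"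
    "0 < rho2 (laplacian A)" "rho2 (laplacian A) \<le> rho (laplacian A)"
proof -
  let ?L = "laplacian A" and ?S = "{u::real^'n. (\<Sum>i\<in>UNIV. u$i) = 0}"
  have "?L *v u \<in> ?S" for u
  proof -
    have "(\<Sum>i\<in>UNIV. (?L *v u)$i) = (\<Sum>j\<in>UNIV. (\<Sum>i\<in>UNIV. ?L$i$j) * u$j)"
      unfolding matrix_vector_mult_def by (simp add: sum_distrib_right) (rule sum.swap)
    thus ?thesis by (simp add: laplacian_sum_zero[OF adj])
  qed
  moreover have "subspace ?S" by (auto simp: subspace_def sum.distrib sum_distrib_left[symmetric])
  ultimately obtain B where B: "B \<subseteq> ?S" "pairwise orthogonal B"
      "\<And>b. b \<in> B \<Longrightarrow> norm b = 1 \<and> (\<exists>c. ?L *v b = c *\<^sub>R b)" "span B = ?S"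
    using selfadjoint_eigenbasis[OF matrix_vector_mul_linear laplacian_selfadjoint[OF adj], of ?S] by blast
  then obtain l where l: "\<And>b. b \<in> B \<Longrightarrow> ?L *v b = l b *\<^sub>R b" by metis
  have fin: "finite B"
    using pairwise_orthogonal_independent[OF B(2)] B(3) independent_bound by fastforce
  have lpos: "l b > 0" if "b \<in> B" for b
  proof -
    have "b \<noteq> 0" using B(3)[OF that] by force
    hence "b \<bullet> (?L *v b) > 0"
      using that B by (intro laplacian_form_pos[OF adj con]) auto
    thus ?thesis using that B(3)[of b] by (simp add: l dot_square_norm)
  qed
  \<comment> \<open>An eigenvector for any other \<open>c\<close> is orthogonal to \<open>B\<close>.
    As \<open>c\<close> is nonzero, it has zero sum like everything in the range of
    \<open>?L\<close>, hence lies in \<open>span B\<close> and must vanish.\<close>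
  have ev: "c \<in> insert 0 (l ` B)" if "c \<in> mat_eigenvalues ?L" for c
  proof (rule ccontr)
    assume c: "c \<notin> insert 0 (l ` B)"
    from that obtain u where u: "u \<noteq> 0" "?L *v u = c *\<^sub>R u" by (auto simp: mat_eigenvalues_def)
    have "b \<bullet> u = 0" if "b \<in> B" for b
    proof -
      have "l b * (b \<bullet> u) = c * (b \<bullet> u)"
        using laplacian_selfadjoint[OF adj, of b u] that by (simp add: l u)
      thus ?thesis using c that by auto
    qed
    moreover have "u \<in> span B"
    proof -
      have "c *\<^sub>R u \<in> ?S" using \<open>\<And>u. ?L *v u \<in> ?S\<close>[of u] u(2) by simp
      hence "c * (\<Sum>i\<in>UNIV. u$i) = 0" by (simp add: sum_distrib_left)
      thus ?thesis using c B(4) by auto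
    qed
    ultimately have "(norm u)\<^sup>2 = 0"
      using orthonormal_Parseval[OF B(2), of u] B(3) by simp
    with u show False by simp
  qed
  have mem: "l b \<in> mat_eigenvalues ?L" if "b \<in> B" for b
  proof -
    have "b \<noteq> 0" using B(3)[OF that] by force
    thus ?thesis using l[OF that] unfolding mat_eigenvalues_def by blast
  qed
  have finE: "finite (mat_eigenvalues ?L)"
    using ev fin by (meson finite_imageI finite_insert finite_subset subsetI)
  \<comment> \<open>Two vertices give a nonzero zero-sum vector, so \<open>B\<close> is nonempty and
    the \<open>Min\<close> in \<open>rho2\<close> ranges over a nonempty set.\<close>
  obtain i j :: 'n where "i \<noteq> j"
    using n2 by (metis card_2_iff' ex_card subset_UNIV)
  hence d: "axis i 1 - axis j (1::real) \<in> ?S" "axis i 1 - axis j (1::real) \<noteq> 0"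
    by (auto simp: sum_subtractf axis_def vec_eq_iff)
  have "B \<noteq> {}"
  proof
    assume "B = {}"
    hence "?S = {0}" using B(4) by simp
    thus False using d by blast
  qed
  then obtain b where b: "b \<in> B" by blast
  have finP: "finite {c \<in> mat_eigenvalues ?L. 0 < c}" using finE by simp
  have le: "rho2 ?L \<le> l b \<and> l b \<le> rho ?L" if "b \<in> B" for b
    using mem[OF that] lpos[OF that] finE finP unfolding rho2_def rho_def by (auto intro: Min_le Max_ge)
  have "rho2 ?L \<in> {c \<in> mat_eigenvalues ?L. 0 < c}"
    unfolding rho2_def using mem[OF b] lpos[OF b] finP by (intro Min_in) auto
  hence "0 < rho2 ?L" by simp
  moreover have "rho2 ?L \<le> rho ?L" using le[OF b] by simp
  ultimately show ?thesis using that[of B l] fin B l le by blast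
qed

section \<open>Scalar estimates\<close>

text \<open>Contribution of one eigenvector of the Laplacian (eigenvalue \<open>l\<close>) and one coordinate to the
  quadratic part of the Lyapunov function; \<open>1 / l\<close> stems from the pseudo-inverse of the Laplacian.\<close>
definition mode_energy :: "real \<Rightarrow> real \<Rightarrow> real \<Rightarrow> real \<Rightarrow> real \<Rightarrow> real" where
  "mode_energy \<alpha> \<beta> l y w = y\<^sup>2 / 2 + (1 / l + \<alpha> / \<beta>) * w\<^sup>2 / 2 + y * w"

text \<open>The factor in \<^const>\<open>eps12\<close> in front of \<open>3 n p Lf\<^sup>2 / 4\<close>.\<close>
definition drift_coeff :: "real \<Rightarrow> real \<Rightarrow> real \<Rightarrow> real \<Rightarrow> real" where
  "drift_coeff \<alpha> \<beta> \<eta> r2 = (1 / \<beta>\<^sup>2 + 1 / (2 * \<eta> * \<beta>)) * (1 / r2 + \<alpha> / \<beta>)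
     + 1 / (2 * \<eta> * \<beta>\<^sup>2) + 1 / \<beta>\<^sup>2 + 1 / 2"

text \<open>Here \<open>b\<close>, \<open>a\<close>, \<open>q\<close> stand for \<beta>, \<alpha> /
  \<beta> and the inverse eigenvalue. The weight \<open>q + a\<close> on \<open>w^2\<close> is
  exactly the one for which all products \<open>w * y\<close> of first order in \<eta> cancel. The
  mixed term \<open>y * w\<close> of the energy supplies the dissipation
  \<open>- \<eta> * b * w^2\<close>, which the update of \<open>w\<close> alone would not
  give.\<close>

lemma mode_energy_expansion:
  fixes y w e c a b q l \<eta> :: real
  assumes ql: "q * l = 1" and y': "y' = y - \<eta> * (a * b * l * y + b * w + e)"
    and w': "w' = w + \<eta> * b * l * y + c"
  shows "y'\<^sup>2 / 2 + (q + a) * w'\<^sup>2 / 2 + y' * w' = y\<^sup>2 / 2 + (q + a) * w\<^sup>2 / 2 + y * w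
    - \<eta> * b * (a - 1) * l * y\<^sup>2 - \<eta> * b * w\<^sup>2 - \<eta> * e * y - \<eta> * e * w + (q + a) * w * c
    + y * c + \<eta> * b * y * c - \<eta> * b * w * c - \<eta> * e * c + (q + a) * c\<^sup>2 / 2
    + \<eta>\<^sup>2 * (b\<^sup>2 * l * y\<^sup>2 / 2 + b\<^sup>2 * a * (a - 1) * l\<^sup>2 * y\<^sup>2 / 2 + b\<^sup>2 * (a - 1) * l * w * y
       + b * (a - 1) * l * y * e + b\<^sup>2 * w\<^sup>2 / 2 + b * w * e + e\<^sup>2 / 2)"
proof -
  \<comment> \<open>The two sides differ by a multiple of \<open>q * l - 1\<close>; with the
    cofactor written out, a polynomial identity remains.\<close>
  have "2 * (y'\<^sup>2 / 2 + (q + a) * w'\<^sup>2 / 2 + y' * w') = 2 * (y\<^sup>2 / 2 + (q + a) * w\<^sup>2 / 2 + y * w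
    - \<eta> * b * (a - 1) * l * y\<^sup>2 - \<eta> * b * w\<^sup>2 - \<eta> * e * y - \<eta> * e * w + (q + a) * w * c
    + y * c + \<eta> * b * y * c - \<eta> * b * w * c - \<eta> * e * c + (q + a) * c\<^sup>2 / 2
    + \<eta>\<^sup>2 * (b\<^sup>2 * l * y\<^sup>2 / 2 + b\<^sup>2 * a * (a - 1) * l\<^sup>2 * y\<^sup>2 / 2 + b\<^sup>2 * (a - 1) * l * w * y
       + b * (a - 1) * l * y * e + b\<^sup>2 * w\<^sup>2 / 2 + b * w * e + e\<^sup>2 / 2))
    + (q * l - 1) * (2 * w * \<eta> * b * y + \<eta>\<^sup>2 * b\<^sup>2 * l * y\<^sup>2 + 2 * \<eta> * b * y * c)"
    unfolding y' w' by (simp add: power2_eq_square field_simps)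
  thus ?thesis using ql by simp
qed

lemma product_le_half_squares:
  fixes u v :: real
  shows "u * v \<le> u\<^sup>2 / 2 + v\<^sup>2 / 2" "- u * v \<le> u\<^sup>2 / 2 + v\<^sup>2 / 2"
  using zero_le_power2[of "u - v"] zero_le_power2[of "u + v"]
  by (simp_all add: power2_eq_square algebra_simps)

text \<open>Every mixed term is split by Young's inequality. The products \<open>w * c\<close> and
  \<open>y * c\<close> carry no factor \<eta>, so the split is weighted to leave only order \<eta>
  on \<open>w^2\<close> and \<open>y^2\<close>. The price is the factor \<open>1 / \<eta>\<close> on
  \<open>c^2\<close>, which is the origin of the terms with \<open>1 / (2 * \<eta>)\<close> in
  \<open>drift_coeff\<close>.\<close>

lemma mode_energy_descent_aux:
  fixes y w e c a b q l \<eta> :: real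
  assumes ql: "q * l = 1" "q > 0" "l > 0" and ab: "a > 1" "b > 0" "\<eta> > 0"
    and y': "y' = y - \<eta> * (a * b * l * y + b * w + e)"
    and w': "w' = w + \<eta> * b * l * y + c"
  shows "y'\<^sup>2 / 2 + (q + a) * w'\<^sup>2 / 2 + y' * w' \<le> y\<^sup>2 / 2 + (q + a) * w\<^sup>2 / 2 + y * w
    - \<eta> * (b * (a - 1) * l - 1
        - \<eta> * (b\<^sup>2 * l + b\<^sup>2 * a * (a - 1) * l\<^sup>2 / 2 + b\<^sup>2 * (a - 1)\<^sup>2 * l\<^sup>2)) * y\<^sup>2
    - \<eta> * (b - 1 / 2 - (q + a) / (2 * b) - \<eta> * (3 / 2 * b\<^sup>2 + 1 / 2)) * w\<^sup>2
    + (\<eta> + 2 * \<eta>\<^sup>2) * e\<^sup>2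
    + (b / (2 * \<eta>) * (q + a) + 1 / (2 * \<eta>) + q / 2 + b\<^sup>2 / 2 + 1 / 2 + (q + a) / 2) * c\<^sup>2"
proof -
  define K1 where "K1 = (q + a) / (2 * b)"
  define K2 where "K2 = b / (2 * \<eta>) * (q + a)"
  define K3 where "K3 = 1 / (2 * \<eta>)"
  have t1: "\<eta> * (- e * y) \<le> \<eta> * (e\<^sup>2 / 2 + y\<^sup>2 / 2)"
    and t2: "\<eta> * (- e * w) \<le> \<eta> * (e\<^sup>2 / 2 + w\<^sup>2 / 2)"
    using ab by (intro mult_left_mono product_le_half_squares; simp)+
  have "(q + a) * \<eta> / (2 * b) * (w - b * c / \<eta>)\<^sup>2 \<ge> 0" using ql ab by simp
  also have "(q + a) * \<eta> / (2 * b) * (w - b * c / \<eta>)\<^sup>2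
      = \<eta> * K1 * w\<^sup>2 - (q + a) * w * c + K2 * c\<^sup>2"
    unfolding K1_def K2_def using ab by (simp add: power2_eq_square field_simps)
  finally have t3: "(q + a) * w * c \<le> \<eta> * K1 * w\<^sup>2 + K2 * c\<^sup>2"
    by simp
  have "\<eta> / 2 * (y - c / \<eta>)\<^sup>2 \<ge> 0" using ab by simp
  also have "\<eta> / 2 * (y - c / \<eta>)\<^sup>2 = \<eta> * y\<^sup>2 / 2 - y * c + K3 * c\<^sup>2"
    unfolding K3_def using ab by (simp add: power2_eq_square field_simps)
  finally have t4: "y * c \<le> \<eta> * y\<^sup>2 / 2 + K3 * c\<^sup>2" by simp
  have "q / 2 * (\<eta> * b * l * y - c)\<^sup>2 \<ge> 0" using ql by simp
  also have "q / 2 * (\<eta> * b * l * y - c)\<^sup>2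
     = (q * l) * \<eta>\<^sup>2 * b\<^sup>2 * l * y\<^sup>2 / 2 - (q * l) * \<eta> * b * y * c + q / 2 * c\<^sup>2"
    by (simp add: power2_eq_square field_simps)
  finally have t5: "\<eta> * b * y * c \<le> \<eta>\<^sup>2 * (b\<^sup>2 * l * y\<^sup>2 / 2) + q / 2 * c\<^sup>2" using ql by simp
  have t6: "- \<eta> * b * w * c \<le> \<eta>\<^sup>2 * w\<^sup>2 / 2 + b\<^sup>2 / 2 * c\<^sup>2"
    using product_le_half_squares(2)[of "\<eta> * w" "b * c"] by (simp add: power_mult_distrib mult_ac)
  have t7: "- \<eta> * e * c \<le> \<eta>\<^sup>2 * e\<^sup>2 / 2 + c\<^sup>2 / 2"
    using product_le_half_squares(2)[of "\<eta> * e" c] by (simp add: power_mult_distrib mult_ac)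
  have "b\<^sup>2 * (a - 1) * l * w * y \<le> b\<^sup>2 * w\<^sup>2 / 2 + b\<^sup>2 * (a - 1)\<^sup>2 * l\<^sup>2 * y\<^sup>2 / 2"
    using product_le_half_squares(1)[of "b * w" "b * (a - 1) * l * y"]
    by (simp add: power_mult_distrib mult_ac) (simp add: power2_eq_square mult_ac)
  moreover have "b * (a - 1) * l * y * e \<le> b\<^sup>2 * (a - 1)\<^sup>2 * l\<^sup>2 * y\<^sup>2 / 2 + e\<^sup>2 / 2"
    using product_le_half_squares(1)[of "b * (a - 1) * l * y" e] by (simp add: power_mult_distrib mult_ac)
  moreover have "b * w * e \<le> b\<^sup>2 * w\<^sup>2 / 2 + e\<^sup>2 / 2"
    using product_le_half_squares(1)[of "b * w" e] by (simp add: power_mult_distrib mult_ac)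
  ultimately have t8: "\<eta>\<^sup>2 * (b\<^sup>2 * l * y\<^sup>2 / 2 + b\<^sup>2 * a * (a - 1) * l\<^sup>2 * y\<^sup>2 / 2 + b\<^sup>2 * (a - 1) * l * w * y
       + b * (a - 1) * l * y * e + b\<^sup>2 * w\<^sup>2 / 2 + b * w * e + e\<^sup>2 / 2)
     \<le> \<eta>\<^sup>2 * (b\<^sup>2 * l * y\<^sup>2 / 2 + b\<^sup>2 * a * (a - 1) * l\<^sup>2 * y\<^sup>2 / 2 + 3 / 2 * b\<^sup>2 * w\<^sup>2
       + b\<^sup>2 * (a - 1)\<^sup>2 * l\<^sup>2 * y\<^sup>2 + 3 / 2 * e\<^sup>2)"
    by (intro mult_left_mono) auto
  show ?thesis
    unfolding mode_energy_expansion[OF ql(1) y' w'] K1_def[symmetric] K2_def[symmetric] K3_def[symmetric]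
    using t1 t2 t3 t4 t5 t6 t7 t8 by (simp add: power2_eq_square algebra_simps add_divide_distrib diff_divide_distrib)
qed

text \<open>The coefficients are made independent of the eigenvalue \<open>l\<close>, so that the
  estimates of all modes can be summed by Parseval. The perturbation is \<open>d / \<beta>\<close>
  because \<open>h0\<close> enters the shifted dual variable divided by \<beta>.\<close>

lemma mode_energy_descent:
  fixes y w e d \<alpha> \<beta> \<eta> l r r2 :: real
  assumes par: "\<beta> > 0" "\<alpha> > \<beta>" "\<eta> > 0" and l: "0 < r2" "r2 \<le> l" "l \<le> r"
  shows "mode_energy \<alpha> \<beta> l (y - \<eta> * (\<alpha> * l * y + \<beta> * w + e)) (w + \<eta> * \<beta> * l * y + d / \<beta>)
    \<le> mode_energy \<alpha> \<beta> l y w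
      - \<eta> * ((\<alpha> - \<beta>) * r2 - 1 - \<eta> * (\<beta>\<^sup>2 * r + (2 * \<alpha>\<^sup>2 + \<beta>\<^sup>2) * r\<^sup>2)) * y\<^sup>2
      - \<eta> * (eps3 \<alpha> \<beta> r2 - \<eta> * eps4 \<beta>) * w\<^sup>2
      + (\<eta> + 5 / 2 * \<eta>\<^sup>2) * e\<^sup>2 + drift_coeff \<alpha> \<beta> \<eta> r2 * d\<^sup>2"
proof -
  define a where "a = \<alpha> / \<beta>"
  define q where "q = 1 / l"
  have a: "a > 1" "\<alpha> = a * \<beta>" using par by (auto simp: a_def)
  have q: "q * l = 1" "q > 0" "l > 0" "q \<le> 1 / r2" using l by (auto simp: q_def frac_le)
  have "\<eta> * (\<beta> * (a - 1) * r2 - 1 - \<eta> * (\<beta>\<^sup>2 * r + (2 * \<alpha>\<^sup>2 + \<beta>\<^sup>2) * r\<^sup>2))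
    \<le> \<eta> * (\<beta> * (a - 1) * l - 1
        - \<eta> * (\<beta>\<^sup>2 * l + \<beta>\<^sup>2 * a * (a - 1) * l\<^sup>2 / 2 + \<beta>\<^sup>2 * (a - 1)\<^sup>2 * l\<^sup>2))"
  proof -
    have 1: "\<beta> * (a - 1) * r2 \<le> \<beta> * (a - 1) * l" using par a l by (intro mult_left_mono) auto
    have "a * (a - 1) / 2 + (a - 1)\<^sup>2 \<le> 2 * a\<^sup>2 + 1"
      using a zero_le_power2[of a] by (simp add: power2_eq_square algebra_simps)
    hence "\<beta>\<^sup>2 * (a * (a - 1) / 2 + (a - 1)\<^sup>2) \<le> \<beta>\<^sup>2 * (2 * a\<^sup>2 + 1)" by (intro mult_left_mono) auto
    also have "\<dots> = 2 * \<alpha>\<^sup>2 + \<beta>\<^sup>2" by (simp add: a(2) power_mult_distrib algebra_simps)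
    finally have "\<beta>\<^sup>2 * (a * (a - 1) / 2 + (a - 1)\<^sup>2) * l\<^sup>2 \<le> (2 * \<alpha>\<^sup>2 + \<beta>\<^sup>2) * r\<^sup>2"
      using l by (intro mult_mono power_mono) auto
    moreover have "\<beta>\<^sup>2 * l \<le> \<beta>\<^sup>2 * r" using l by (intro mult_left_mono) auto
    ultimately have "\<beta>\<^sup>2 * l + \<beta>\<^sup>2 * a * (a - 1) * l\<^sup>2 / 2 + \<beta>\<^sup>2 * (a - 1)\<^sup>2 * l\<^sup>2
        \<le> \<beta>\<^sup>2 * r + (2 * \<alpha>\<^sup>2 + \<beta>\<^sup>2) * r\<^sup>2" by (simp add: algebra_simps)
    hence "\<eta> * (\<beta>\<^sup>2 * l + \<beta>\<^sup>2 * a * (a - 1) * l\<^sup>2 / 2 + \<beta>\<^sup>2 * (a - 1)\<^sup>2 * l\<^sup>2)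
        \<le> \<eta> * (\<beta>\<^sup>2 * r + (2 * \<alpha>\<^sup>2 + \<beta>\<^sup>2) * r\<^sup>2)" using par by (intro mult_left_mono) auto
    hence "\<beta> * (a - 1) * r2 - 1 - \<eta> * (\<beta>\<^sup>2 * r + (2 * \<alpha>\<^sup>2 + \<beta>\<^sup>2) * r\<^sup>2)
      \<le> \<beta> * (a - 1) * l - 1
        - \<eta> * (\<beta>\<^sup>2 * l + \<beta>\<^sup>2 * a * (a - 1) * l\<^sup>2 / 2 + \<beta>\<^sup>2 * (a - 1)\<^sup>2 * l\<^sup>2)"
      using 1 by linarith
    thus ?thesis by (rule mult_left_mono) (use par in simp)
  qed
  hence Y: "\<eta> * ((\<alpha> - \<beta>) * r2 - 1 - \<eta> * (\<beta>\<^sup>2 * r + (2 * \<alpha>\<^sup>2 + \<beta>\<^sup>2) * r\<^sup>2)) * y\<^sup>2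
    \<le> \<eta> * (\<beta> * (a - 1) * l - 1
        - \<eta> * (\<beta>\<^sup>2 * l + \<beta>\<^sup>2 * a * (a - 1) * l\<^sup>2 / 2 + \<beta>\<^sup>2 * (a - 1)\<^sup>2 * l\<^sup>2)) * y\<^sup>2"
    by (intro mult_right_mono) (auto simp: a(2) algebra_simps)
  have "eps3 \<alpha> \<beta> r2 = \<beta> - 1 / 2 - (1 / r2 + a) / (2 * \<beta>)"
    using par l by (simp add: eps3_def a(2) power2_eq_square field_simps)
  also have "\<dots> \<le> \<beta> - 1 / 2 - (q + a) / (2 * \<beta>)"
    using par q by (simp add: divide_right_mono)
  finally have "eps3 \<alpha> \<beta> r2 - \<eta> * eps4 \<beta> \<le> \<beta> - 1 / 2 - (q + a) / (2 * \<beta>) - \<eta> * (3 / 2 * \<beta>\<^sup>2 + 1 / 2)"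
    unfolding eps4_def using par
    by (intro diff_mono mult_left_mono) auto
  hence W: "\<eta> * (eps3 \<alpha> \<beta> r2 - \<eta> * eps4 \<beta>) * w\<^sup>2
      \<le> \<eta> * (\<beta> - 1 / 2 - (q + a) / (2 * \<beta>) - \<eta> * (3 / 2 * \<beta>\<^sup>2 + 1 / 2)) * w\<^sup>2"
    using par by (intro mult_right_mono mult_left_mono) auto
  have E: "(\<eta> + 2 * \<eta>\<^sup>2) * e\<^sup>2 \<le> (\<eta> + 5 / 2 * \<eta>\<^sup>2) * e\<^sup>2"
    by (intro mult_right_mono) auto
  have "\<beta> / (2 * \<eta>) * (q + a) + 1 / (2 * \<eta>) + q / 2 + \<beta>\<^sup>2 / 2 + 1 / 2 + (q + a) / 2
     = (1 + \<beta> / (2 * \<eta>)) * (q + a) - a / 2 + 1 / (2 * \<eta>) + \<beta>\<^sup>2 / 2 + 1 / 2"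
    by (simp add: distrib_right distrib_left) (simp add: field_simps)
  also have "\<dots> \<le> (1 + \<beta> / (2 * \<eta>)) * (1 / r2 + a) + 1 / (2 * \<eta>) + \<beta>\<^sup>2 / 2 + 1"
  proof -
    have "(1 + \<beta> / (2 * \<eta>)) * (q + a) \<le> (1 + \<beta> / (2 * \<eta>)) * (1 / r2 + a)"
      using par q by (intro mult_left_mono) auto
    thus ?thesis using a by simp
  qed
  also have "\<dots> = drift_coeff \<alpha> \<beta> \<eta> r2 * \<beta>\<^sup>2"
    using par l unfolding drift_coeff_def a_def[symmetric] by (simp add: power2_eq_square field_simps)
  finally have "(\<beta> / (2 * \<eta>) * (q + a) + 1 / (2 * \<eta>) + q / 2 + \<beta>\<^sup>2 / 2 + 1 / 2 + (q + a) / 2) * (d / \<beta>)\<^sup>2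
      \<le> drift_coeff \<alpha> \<beta> \<eta> r2 * \<beta>\<^sup>2 * (d / \<beta>)\<^sup>2" by (intro mult_right_mono) auto
  also have "\<dots> = drift_coeff \<alpha> \<beta> \<eta> r2 * d\<^sup>2" using par by (simp add: power_divide)
  finally have D: "(\<beta> / (2 * \<eta>) * (q + a) + 1 / (2 * \<eta>) + q / 2 + \<beta>\<^sup>2 / 2 + 1 / 2 + (q + a) / 2) * (d / \<beta>)\<^sup>2
      \<le> drift_coeff \<alpha> \<beta> \<eta> r2 * d\<^sup>2" .
  show ?thesis
    unfolding mode_energy_def a_def[symmetric] q_def[symmetric]
    using mode_energy_descent_aux[OF q(1-3) a(1) par(1,3) refl refl, of y w e "d / \<beta>"] Y W E D
    by (simp only: a(2))
qed

text \<open>Completing the square in \<open>w\<close> leaves \<open>(1 - 1 / m) / 2\<close> on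
  \<open>y^2\<close> with \<open>m = 1 / l + \<alpha> / \<beta>\<close>. This grows with
  \<open>m\<close>, so the largest eigenvalue is the worst case.\<close>

lemma mode_energy_lower:
  assumes "\<beta> > 0" "\<alpha> > \<beta>" "0 < l" "l \<le> r"
  shows "(1 - 1 / (1 / r + \<alpha> / \<beta>)) / 2 * y\<^sup>2 \<le> mode_energy \<alpha> \<beta> l y w"
proof -
  define m where "m = 1 / l + \<alpha> / \<beta>"
  have m: "m > 0" "1 / r + \<alpha> / \<beta> \<le> m" "1 / r + \<alpha> / \<beta> > 0"
    using assms by (auto simp: m_def frac_le add_pos_pos)
  have "(1 - 1 / (1 / r + \<alpha> / \<beta>)) / 2 * y\<^sup>2 \<le> (1 - 1 / m) / 2 * y\<^sup>2"
    using m by (intro mult_right_mono divide_right_mono diff_left_mono frac_le) auto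
  moreover have "mode_energy \<alpha> \<beta> l y w - (1 - 1 / m) / 2 * y\<^sup>2 = m / 2 * (w + y / m)\<^sup>2"
    using m unfolding mode_energy_def m_def[symmetric] by (simp add: power2_eq_square field_simps)
  moreover have "m / 2 * (w + y / m)\<^sup>2 \<ge> 0" using m by simp
  ultimately show ?thesis by linarith
qed

lemma mode_energy_upper:
  assumes "\<beta> > 0" "\<alpha> > \<beta>" "0 < r2" "r2 \<le> l"
  shows "mode_energy \<alpha> \<beta> l y w \<le> eps8 \<alpha> \<beta> r2 * (y\<^sup>2 + w\<^sup>2)"
proof -
  have e8: "eps8 \<alpha> \<beta> r2 = (1 / r2 + \<alpha> / \<beta> + 1) / 2"
    using assms by (simp add: eps8_def field_simps)
  have "1 / l \<le> 1 / r2" using assms by (intro frac_le) auto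
  hence "(1 / l + \<alpha> / \<beta>) * w\<^sup>2 / 2 \<le> (1 / r2 + \<alpha> / \<beta>) * w\<^sup>2 / 2"
    by (intro divide_right_mono mult_right_mono) auto
  hence "mode_energy \<alpha> \<beta> l y w \<le> y\<^sup>2 + ((1 / r2 + \<alpha> / \<beta>) * w\<^sup>2 / 2 + w\<^sup>2 / 2)"
    using product_le_half_squares(1)[of y w] unfolding mode_energy_def by argo
  moreover have "1 + 0 \<le> \<alpha> / \<beta> + 1 / r2" using assms by (intro add_mono) auto
  hence "1 \<le> eps8 \<alpha> \<beta> r2" by (simp add: e8 add.commute)
  hence "y\<^sup>2 * 1 \<le> y\<^sup>2 * eps8 \<alpha> \<beta> r2" by (intro mult_left_mono) auto
  moreover have "eps8 \<alpha> \<beta> r2 * w\<^sup>2 = (1 / r2 + \<alpha> / \<beta>) * w\<^sup>2 / 2 + w\<^sup>2 / 2"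
    by (simp add: e8 algebra_simps)
  ultimately show ?thesis
    unfolding distrib_left by (simp add: mult.commute)
qed

text \<open>With \<open>a = \<alpha> / \<beta>\<close>, \<open>s = 1 / \<rho>(L)\<close>, \<open>u\<close> and \<open>e\<close> playing the roles of \<^const>\<open>eps10t\<close> and \<^const>\<open>eps8\<close>: the
  constant \<^const>\<open>eps9\<close> is smaller than the coercivity constant of the energy by at least one contraction
  factor.\<close>
lemma rate_slack:
  fixes a s u e :: real
  assumes a: "a > 1" and s: "s > 0" and u: "0 \<le> u" "u \<le> (a - 1) * s / (s + 2 * a\<^sup>2 + 1)"
    and e: "e \<ge> (a + 1 + s) / 2"
  shows "min s ((a - 1) / a) \<le> (1 - u / e) * (1 - 1 / (s + a))"
    and "u / e \<le> 1 / a"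
    and "2 * (a - 1) / a \<le> (1 - u / e) * e"
proof -
  \<comment> \<open>The quotient of the upper bound on \<open>u\<close> and the lower bound on
    \<open>e\<close>, hence an upper bound for the rate \<open>u / e\<close>.\<close>
  define E where "E = 2 * (a - 1) * s / ((s + 2 * a\<^sup>2 + 1) * (a + 1 + s))"
  have pos: "s + 2 * a\<^sup>2 + 1 > 0" "a + 1 + s > 0" "e > 0" using a s e by (auto simp: add_pos_pos)
  have "u / e \<le> ((a - 1) * s / (s + 2 * a\<^sup>2 + 1)) / ((a + 1 + s) / 2)"
    using u e pos by (intro frac_le) auto
  also have "\<dots> = E" by (simp add: E_def field_simps)
  finally have uE: "u / e \<le> E" .
  have asq: "a \<le> a\<^sup>2" using a by (simp add: power2_eq_square)
  have "E * a \<le> 1"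
  proof -
    have "2 * a * (a - 1) * s \<le> (2 * a\<^sup>2 + 1) * s"
      using a s by (intro mult_right_mono) (auto simp: power2_eq_square algebra_simps)
    also have "\<dots> \<le> (s + 2 * a\<^sup>2 + 1) * (a + 1 + s)"
      using a s pos by (intro mult_mono) auto
    finally have "2 * a * (a - 1) * s / ((s + 2 * a\<^sup>2 + 1) * (a + 1 + s)) \<le> 1" using pos by simp
    thus ?thesis by (simp add: E_def mult_ac)
  qed
  moreover have "u / e * a \<le> E * a" using uE a by (intro mult_right_mono) auto
  ultimately have "u / e * a \<le> 1" by linarith
  thus "u / e \<le> 1 / a" using a by (simp add: field_simps)
  show "2 * (a - 1) / a \<le> (1 - u / e) * e"
  proof -
    have "(a - 1) * s / (s + 2 * a\<^sup>2 + 1) \<le> s / 2"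
    proof -
      have "2 * (a - 1) * s \<le> (s + 2 * a\<^sup>2 + 1) * s"
        using a s asq by (intro mult_right_mono) auto
      thus ?thesis using pos by (simp add: field_simps)
    qed
    with u(2) have "u \<le> s / 2" by (rule order.trans)
    moreover have "(1 - u / e) * e = e - u" using pos by (simp add: field_simps)
    ultimately have "(1 - u / e) * e \<ge> (a + 1) / 2" using e by simp
    \<comment> \<open>Cleared of denominators this is \<open>a^2 - 3 * a + 4 \<ge> 0\<close>, and
      four times the left side is \<open>(2 * a - 3)^2 + 7\<close>.\<close>
    moreover have "2 * (a - 1) / a \<le> (a + 1) / 2"
      using a zero_le_power2[of "2 * a - 3"] by (simp add: power2_eq_square field_simps)
    ultimately show ?thesis by linarith
  qed
  have pa: "s + a > 0" "a - 1 + s > 0" using a s by auto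
  define x where "x = u / e"
  have xE: "x \<le> E" using uE by (simp add: x_def)
  have fr: "1 - 1 / (s + a) = (a - 1 + s) / (s + a)" using pa by (simp add: field_simps)
  \<comment> \<open>The cases decide which entry attains the minimum. If it is
    \<open>(a - 1) / a\<close>, clearing denominators leaves exactly \<open>s\<close> as room for
    \<open>x * (a * (a - 1 + s))\<close>; if it is \<open>s\<close>, the room for
    \<open>x * (a - 1 + s)\<close> is \<open>a - 1 + s - s * (s + a)\<close>.\<close>
  have "min s ((a - 1) / a) \<le> (1 - x) * (1 - 1 / (s + a))"
  proof (cases "s * a \<ge> a - 1")
    case True
    have "2 * (a - 1) * a * (a - 1 + s) \<le> (s + 2 * a\<^sup>2 + 1) * (a + 1 + s)"
    proof -
      have "0 \<le> 6 * a\<^sup>2 + (a * s * 3 + 2 * s + s\<^sup>2 - a + 1)"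
      proof -
        have "0 \<le> a * s * 3" using a s by simp
        thus ?thesis using a s asq zero_le_power2[of s] by linarith
      qed
      thus ?thesis by (simp add: power2_eq_square algebra_simps)
    qed
    hence "2 * (a - 1) * a * (a - 1 + s) * s \<le> (s + 2 * a\<^sup>2 + 1) * (a + 1 + s) * s"
      using s by (intro mult_right_mono) auto
    hence "E * (a * (a - 1 + s)) \<le> s"
      using pos by (simp add: E_def divide_le_eq mult_ac)
    moreover have "x * (a * (a - 1 + s)) \<le> E * (a * (a - 1 + s))"
      using xE a pa by (intro mult_right_mono) auto
    ultimately have "(a - 1) * (s + a) \<le> (1 - x) * (a - 1 + s) * a"
      by (simp add: algebra_simps)
    hence "(a - 1) / a \<le> (1 - x) * ((a - 1 + s) / (s + a))"
      using a pa by (simp add: divide_le_eq pos_le_divide_eq mult_ac)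
    thus ?thesis unfolding fr by linarith
  next
    case False
    hence sa: "s * a \<le> a - 1" by simp
    have "E * (a - 1 + s) * a\<^sup>2 \<le> a - 1"
    proof -
      have 1: "(a - 1 + s) * a \<le> (a - 1) * (a + 1)" using sa by (simp add: algebra_simps)
      have 2: "2 * (a - 1) * (s * a) \<le> 2 * (a - 1) * (a - 1)"
        using a sa by (intro mult_left_mono) auto
      have "2 * (a - 1) * (s * a) * ((a - 1 + s) * a) \<le> 2 * (a - 1) * (a - 1) * ((a - 1) * (a + 1))"
        by (rule mult_mono[OF 2 1]) (use a s pa in auto)
      also have "\<dots> = (2 * (a - 1)\<^sup>2) * ((a - 1) * (a + 1))" by (simp add: power2_eq_square)
      also have "\<dots> \<le> (s + 2 * a\<^sup>2 + 1) * ((a - 1) * (a + 1 + s))"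
      proof (rule mult_mono)
        show "2 * (a - 1)\<^sup>2 \<le> s + 2 * a\<^sup>2 + 1"
          using a s by (simp add: power2_eq_square algebra_simps)
        show "(a - 1) * (a + 1) \<le> (a - 1) * (a + 1 + s)" using a s by (intro mult_left_mono) auto
      qed (use a s in auto)
      finally show ?thesis using pos by (simp add: E_def divide_le_eq mult_ac power2_eq_square)
    qed
    \<comment> \<open>The right side decreases in \<open>s\<close> and equals \<open>a - 1\<close>
      at the boundary \<open>s * a = a - 1\<close> of this case.\<close>
    moreover have "a - 1 \<le> (a - 1 + s - s * (s + a)) * a\<^sup>2"
    proof -
      have "s * a * (s * a) \<le> (a - 1) * (s * a)" using sa a s by (intro mult_right_mono) auto
      moreover have "(a - 1) * (a + 1) * (s * a) \<le> (a - 1) * (a + 1) * (a - 1)"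
        using sa a by (intro mult_left_mono) auto
      ultimately show ?thesis by (simp add: power2_eq_square algebra_simps)
    qed
    ultimately have "E * (a - 1 + s) * a\<^sup>2 \<le> (a - 1 + s - s * (s + a)) * a\<^sup>2" by linarith
    hence "E * (a - 1 + s) \<le> a - 1 + s - s * (s + a)" using a by simp
    moreover have "x * (a - 1 + s) \<le> E * (a - 1 + s)"
      using xE pa by (intro mult_right_mono) auto
    ultimately have "s * (s + a) \<le> (1 - x) * (a - 1 + s)" by (simp add: algebra_simps)
    hence "s \<le> (1 - x) * ((a - 1 + s) / (s + a))" using pa by (simp add: pos_le_divide_eq)
    thus ?thesis unfolding fr by linarith
  qed
  thus "min s ((a - 1) / a) \<le> (1 - u / e) * (1 - 1 / (s + a))" by (simp only: x_def)
qed

section \<open>Linear recursion with geometric forcing\<close>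

lemma perturbed_geometric_decay:
  fixes V :: "nat \<Rightarrow> real"
  assumes rec: "\<And>k. V (Suc k) \<le> (1 - et) * V k + e11 * eh ^ k + e12 * eh ^ Suc k"
    and pos: "0 < 1 - et" "0 < eh" "eh < eb" "0 \<le> e11" "0 \<le> e12"
  shows "V k \<le> (1 - et) ^ k * V 0 + phi e11 e12 et eh eb k"
    and "0 \<le> phi e11 e12 et eh eb k"
proof -
  define q where "q = 1 - et"
  have q: "q > 0" using pos by (simp add: q_def)
  \<comment> \<open>The response to the forcing. It telescopes against \<open>q - eh\<close>, so it
    is at most a multiple of \<open>q ^ k\<close> or of \<open>eh ^ k\<close>, according to which
    rate is larger; the remaining factor \<open>q\<close> or \<open>eh\<close> is split off from
    \<open>e11 + e12 * eh\<close> and yields the exponent \<open>k + 1\<close> in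
    \<open>phi\<close>.\<close>
  define S where "S k = (\<Sum>j<k. q ^ (k - Suc j) * eh ^ j)" for k
  have S: "S (Suc k) = q * S k + eh ^ k" for k
  proof -
    have "(\<Sum>j<k. q ^ (k - j) * eh ^ j) = q * S k"
      unfolding S_def sum_distrib_left
      by (rule sum.cong) (auto simp: Suc_diff_Suc power_Suc[symmetric] mult.assoc[symmetric] simp del: power_Suc)
    thus ?thesis by (simp add: S_def)
  qed
  have Sd: "S k * (q - eh) = q ^ k - eh ^ k" for k
  proof (induction k)
    case (Suc k)
    have "S (Suc k) * (q - eh) = q * (S k * (q - eh)) + eh ^ k * (q - eh)"
      by (simp add: S algebra_simps)
    also have "\<dots> = q ^ Suc k - eh ^ Suc k" unfolding Suc by (simp add: algebra_simps)
    finally show ?case .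
  qed (simp add: S_def)
  have Snn: "S k \<ge> 0" for k using q pos by (auto simp: S_def intro!: sum_nonneg)
  have V: "V k \<le> q ^ k * V 0 + (e11 + e12 * eh) * S k" for k
  proof (induction k)
    case (Suc k)
    have "V (Suc k) \<le> q * V k + e11 * eh ^ k + e12 * eh ^ Suc k" using rec by (simp add: q_def)
    also have "\<dots> \<le> q * (q ^ k * V 0 + (e11 + e12 * eh) * S k) + e11 * eh ^ k + e12 * eh ^ Suc k"
      using Suc q by (simp add: mult_left_mono)
    also have "\<dots> = q ^ Suc k * V 0 + (e11 + e12 * eh) * S (Suc k)" by (simp add: S algebra_simps)
    finally show ?case .
  qed (simp add: S_def)
  have e0: "0 \<le> e11 / q + e12" using pos q by simp
  have phi: "(e11 + e12 * eh) * S k \<le> phi e11 e12 et eh eb k"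
  proof (cases q eh rule: linorder_cases)
    case greater
    have "S k \<le> q ^ k / (q - eh)" using greater Sd[of k] pos by (simp add: pos_le_divide_eq)
    moreover have "e11 + e12 * eh \<le> (e11 / q + e12) * q"
      using greater pos q by (simp add: algebra_simps mult_left_mono)
    ultimately have "(e11 + e12 * eh) * S k \<le> ((e11 / q + e12) * q) * (q ^ k / (q - eh))"
      using Snn pos e0 q by (intro mult_mono) auto
    thus ?thesis using greater by (simp add: phi_def q_def[symmetric] mult_ac)
  next
    case less
    have "S k * (eh - q) \<le> eh ^ k" using Sd[of k] q by (simp add: algebra_simps)
    hence "S k \<le> eh ^ k / (eh - q)" using less by (simp add: pos_le_divide_eq)
    moreover have "e11 + e12 * eh \<le> (e11 / q + e12) * eh"
    proof -
      have "e11 * 1 \<le> e11 * (eh / q)" using less pos q by (intro mult_left_mono) auto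
      thus ?thesis by (simp add: algebra_simps)
    qed
    ultimately have "(e11 + e12 * eh) * S k \<le> ((e11 / q + e12) * eh) * (eh ^ k / (eh - q))"
      using Snn pos e0 q by (intro mult_mono) auto
    moreover have eq: "eh - q = eh + et - 1" by (simp add: q_def)
    have "phi e11 e12 et eh eb k = (e11 / q + e12) * (eh ^ (k + 1) / (eh - q))"
      using less unfolding eq by (simp add: phi_def q_def)
    ultimately show ?thesis by (simp add: mult_ac)
  next
    case equal
    \<comment> \<open>At \<open>q = eh\<close> the sum is \<open>k * q ^ (k - 1)\<close> and
      telescoping gives nothing. Enlarging one of the two equal rates to \<open>eb\<close> restores
      it, with denominator \<open>eb - q\<close>.\<close>
    have "S k * q * (eb - q) \<le> eb ^ Suc k"
    proof -
      have "(eb - q) * (\<Sum>i<Suc k. eb ^ i * q ^ (Suc k - Suc i)) = eb ^ Suc k - q ^ Suc k"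
        using power_diff_sumr2[of eb "Suc k" q] by (simp only: mult.commute[of "eb ^ _"])
      moreover have "(\<Sum>i<Suc k. eb ^ i * q ^ (Suc k - Suc i)) \<ge> q * S k"
      proof -
        have "q * S k \<le> S (Suc k)" using pos by (simp add: S)
        also have "\<dots> \<le> (\<Sum>i<Suc k. eb ^ i * q ^ (Suc k - Suc i))"
          unfolding S_def using equal pos q
          by (intro sum_mono) (auto simp: mult.commute intro!: mult_right_mono power_mono)
        finally show ?thesis .
      qed
      hence "(eb - q) * (q * S k) \<le> (eb - q) * (\<Sum>i<Suc k. eb ^ i * q ^ (Suc k - Suc i))"
        using equal pos by (intro mult_left_mono) auto
      ultimately have "(eb - q) * (q * S k) \<le> eb ^ Suc k - q ^ Suc k" by simp
      moreover have "q ^ Suc k \<ge> 0" using q by simp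
      ultimately show ?thesis by (simp add: mult_ac)
    qed
    hence "q * S k \<le> eb ^ Suc k / (eb - q)" using equal pos by (simp add: pos_le_divide_eq mult_ac)
    hence "(e11 / q + e12) * (q * S k) \<le> (e11 / q + e12) * (eb ^ Suc k / (eb - q))"
      using e0 by (rule mult_left_mono)
    moreover have "(e11 + e12 * eh) * S k = (e11 / q + e12) * (q * S k)"
      using equal q by (simp add: field_simps)
    moreover have "phi e11 e12 et eh eb k = (e11 / q + e12) * (eb ^ Suc k / (eb - q))"
      using equal by (simp add: phi_def q_def)
    ultimately show ?thesis by (simp only:)
  qed
  show "V k \<le> (1 - et) ^ k * V 0 + phi e11 e12 et eh eb k"
    using V[of k] phi by (simp add: q_def[symmetric])
  have "0 \<le> (e11 + e12 * eh) * S k" using Snn pos by simp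
  thus "0 \<le> phi e11 e12 et eh eb k" using phi by linarith
qed

section \<open>Lipschitz gradients and the Polyak--Lojasiewicz condition\<close>

text \<open>The descent lemma. The defect of the claim along the segment has a nonpositive
  derivative by Cauchy-Schwarz, so monotonicity replaces an integral of the gradient.\<close>

lemma lipschitz_gradient_upper:
  fixes \<phi> :: "'a::euclidean_space \<Rightarrow> real" and G :: "'a \<Rightarrow> 'a"
  assumes d: "\<And>z. (\<phi> has_derivative (\<lambda>h. G z \<bullet> h)) (at z)"
    and lip: "\<And>y z. norm (G y - G z) \<le> M * norm (y - z)"
  shows "\<phi> (z + h) \<le> \<phi> z + G z \<bullet> h + M / 2 * (norm h)\<^sup>2"
proof -
  define \<psi> where "\<psi> t = \<phi> (z + t *\<^sub>R h) - t * (G z \<bullet> h) - M / 2 * t\<^sup>2 * (norm h)\<^sup>2" for t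
  have D: "(\<psi> has_real_derivative (G (z + t *\<^sub>R h) \<bullet> h - G z \<bullet> h - M * t * (norm h)\<^sup>2)) (at t)" for t
  proof -
    have "((\<lambda>t. \<phi> (z + t *\<^sub>R h)) has_derivative (\<lambda>s. G (z + t *\<^sub>R h) \<bullet> (s *\<^sub>R h))) (at t)"
      by (rule has_derivative_compose[where g = \<phi>, OF _ d]) (auto intro!: derivative_eq_intros)
    hence "((\<lambda>t. \<phi> (z + t *\<^sub>R h)) has_real_derivative (G (z + t *\<^sub>R h) \<bullet> h)) (at t)"
      by (simp add: has_field_derivative_def mult_commute_abs)
    thus ?thesis unfolding \<psi>_def
      by (auto intro!: derivative_eq_intros)
  qed
  have "\<psi> 1 \<le> \<psi> 0"
  proof (rule DERIV_nonpos_imp_nonincreasing[where f = \<psi> and a = 0 and b = 1])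
    fix t :: real assume t: "0 \<le> t" "t \<le> 1"
    have "G (z + t *\<^sub>R h) \<bullet> h - G z \<bullet> h \<le> norm (G (z + t *\<^sub>R h) - G z) * norm h"
      by (metis inner_diff_left norm_cauchy_schwarz)
    also have "\<dots> \<le> (M * norm (t *\<^sub>R h)) * norm h"
      using lip[of "z + t *\<^sub>R h" z] by (intro mult_right_mono) auto
    also have "\<dots> = M * t * (norm h)\<^sup>2" using t by (simp add: power2_eq_square)
    finally show "\<exists>y. (\<psi> has_real_derivative y) (at t) \<and> y \<le> 0" using D[of t] by force
  qed simp
  thus ?thesis by (simp add: \<psi>_def)
qed

lemma lipschitz_gradient_lower:
  fixes \<phi> :: "'a::euclidean_space \<Rightarrow> real" and G :: "'a \<Rightarrow> 'a"
  assumes d: "\<And>z. (\<phi> has_derivative (\<lambda>h. G z \<bullet> h)) (at z)"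
    and lip: "\<And>y z. norm (G y - G z) \<le> M * norm (y - z)"
  shows "\<phi> z + G z \<bullet> h - M / 2 * (norm h)\<^sup>2 \<le> \<phi> (z + h)"
proof -
  have "- \<phi> (z + h) \<le> - \<phi> z + (- G z) \<bullet> h + M / 2 * (norm h)\<^sup>2"
  proof (rule lipschitz_gradient_upper)
    show "((\<lambda>x. - \<phi> x) has_derivative (\<lambda>h. - G z \<bullet> h)) (at z)" for z
      using has_derivative_minus[OF d[of z]] by simp
    show "norm (- G y - - G z) \<le> M * norm (y - z)" for y z
      using lip[of y z] by (metis minus_diff_minus norm_minus_cancel)
  qed
  thus ?thesis by simp
qed

text \<open>Each coordinate of the error is a second-order Taylor remainder divided by the
  difference step, hence at most \<open>M / 2 * \<delta>\<close>; there are \<open>DIM('a)\<close>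
  of them.\<close>

lemma grad_est_error:
  fixes \<phi> :: "'a::euclidean_space \<Rightarrow> real" and G :: "'a \<Rightarrow> 'a"
  assumes d: "\<And>z. (\<phi> has_derivative (\<lambda>h. G z \<bullet> h)) (at z)"
    and lip: "\<And>y z. norm (G y - G z) \<le> M * norm (y - z)" and \<delta>: "0 < \<delta>" "\<delta> \<le> \<Delta>" and M: "M \<ge> 0"
  shows "(norm (grad_est \<phi> z \<delta> - G z))\<^sup>2 \<le> real DIM('a) * M\<^sup>2 * \<Delta>\<^sup>2 / 4"
proof -
  have "((grad_est \<phi> z \<delta> - G z) \<bullet> l)\<^sup>2 \<le> M\<^sup>2 * \<Delta>\<^sup>2 / 4" if l: "l \<in> Basis" for l
  proof -
    have "grad_est \<phi> z \<delta> \<bullet> l = (\<phi> (z + \<delta> *\<^sub>R l) - \<phi> z) / \<delta>"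
      unfolding grad_est_def using l by simp
    hence e: "(grad_est \<phi> z \<delta> - G z) \<bullet> l = (\<phi> (z + \<delta> *\<^sub>R l) - \<phi> z - G z \<bullet> (\<delta> *\<^sub>R l)) / \<delta>"
      using \<delta> by (simp add: inner_diff_left field_simps)
    have "\<bar>\<phi> (z + \<delta> *\<^sub>R l) - \<phi> z - G z \<bullet> (\<delta> *\<^sub>R l)\<bar> \<le> M / 2 * (norm (\<delta> *\<^sub>R l))\<^sup>2"
      using lipschitz_gradient_upper[OF d lip, of z "\<delta> *\<^sub>R l"]
        lipschitz_gradient_lower[OF d lip, of z "\<delta> *\<^sub>R l"] by linarith
    also have "\<dots> = M / 2 * \<delta> * \<delta>" using l \<delta> by (simp add: power2_eq_square)
    finally have "\<bar>(grad_est \<phi> z \<delta> - G z) \<bullet> l\<bar> \<le> M / 2 * \<delta>"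
      unfolding e abs_divide using \<delta> by (simp add: pos_divide_le_eq)
    also have "\<dots> \<le> M / 2 * \<Delta>" using \<delta> M by (intro mult_left_mono) auto
    finally have "\<bar>(grad_est \<phi> z \<delta> - G z) \<bullet> l\<bar>\<^sup>2 \<le> (M / 2 * \<Delta>)\<^sup>2" by (intro power_mono) auto
    thus ?thesis by (simp add: power_mult_distrib power_divide)
  qed
  hence "(\<Sum>l\<in>Basis. ((grad_est \<phi> z \<delta> - G z) \<bullet> l)\<^sup>2) \<le> real DIM('a) * (M\<^sup>2 * \<Delta>\<^sup>2 / 4)"
    by (rule sum_bounded_above)
  moreover have "(\<Sum>l\<in>Basis. ((grad_est \<phi> z \<delta> - G z) \<bullet> l)\<^sup>2) = (norm (grad_est \<phi> z \<delta> - G z))\<^sup>2"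
    unfolding dot_square_norm[symmetric]
    by (subst euclidean_inner[of "grad_est \<phi> z \<delta> - G z"]) (simp only: power2_eq_square)
  ultimately show ?thesis by simp
qed

text \<open>Minimising \<open>sqrt (\<phi> - m) + c * norm (\<cdot> - x)\<close> instead of following the gradient flow: for
  \<open>c < sqrt (\<nu> / 2)\<close> a gradient step would improve any minimiser that is not a zero of \<open>\<phi> - m\<close>.\<close>
lemma PL_near_minimizer:
  fixes \<phi> :: "'a::euclidean_space \<Rightarrow> real" and G :: "'a \<Rightarrow> 'a"
  assumes d: "\<And>z. (\<phi> has_derivative (\<lambda>h. G z \<bullet> h)) (at z)"
    and lip: "\<And>y z. norm (G y - G z) \<le> M * norm (y - z)" and M: "M > 0"
    and m: "\<And>z. m \<le> \<phi> z" and PL: "\<And>z. \<nu> * (\<phi> z - m) \<le> (norm (G z))\<^sup>2 / 2"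
    and c: "0 < c" "c\<^sup>2 < \<nu> / 2"
  shows "\<exists>z. \<phi> z = m \<and> c * norm (z - x) \<le> sqrt (\<phi> x - m)"
proof -
  define r where "r z = sqrt (\<phi> z - m)" for z
  define \<Psi> where "\<Psi> z = r z + c * norm (z - x)" for z
  have r0: "r z \<ge> 0" "(r z)\<^sup>2 = \<phi> z - m" for z using m by (simp_all add: r_def)
  have cont: "continuous_on S \<phi>" for S
    using d by (meson continuous_at_imp_continuous_on has_derivative_continuous)
  \<comment> \<open>Outside this ball the penalty alone exceeds \<open>r x\<close>, the value of
    \<Psi> at \<open>x\<close>, so a minimiser over the compact ball is a global one.\<close>
  define R where "R = r x / c"
  have R: "R \<ge> 0" using r0 c by (simp add: R_def)
  have "continuous_on (cball x R) \<Psi>"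
    unfolding \<Psi>_def r_def by (intro continuous_intros cont)
  then obtain z where z: "z \<in> cball x R" "\<And>y. y \<in> cball x R \<Longrightarrow> \<Psi> z \<le> \<Psi> y"
    using continuous_attains_inf[of "cball x R" \<Psi>] R by auto
  have zx: "\<Psi> z \<le> r x" using z(2)[of x] R by (simp add: \<Psi>_def)
  have zmin: "\<Psi> z \<le> \<Psi> y" for y
  proof (cases "y \<in> cball x R")
    case False
    hence "R * c \<le> norm (y - x) * c"
      using c by (intro mult_right_mono) (auto simp: dist_norm norm_minus_commute)
    hence "r x \<le> \<Psi> y" using c r0(1)[of y] by (simp add: \<Psi>_def R_def mult.commute)
    thus ?thesis using zx by simp
  qed (rule z)
  have "\<phi> z = m"
  proof (rule ccontr)
    assume "\<phi> z \<noteq> m"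
    hence pos: "r z > 0" using m[of z] by (simp add: r_def)
    have \<nu>: "\<nu> > 0" using c zero_le_power2[of c] by linarith
    define N where "N = norm (G z)"
    have N2: "2 * \<nu> * (r z)\<^sup>2 \<le> N\<^sup>2" using PL[of z] by (simp add: r0 N_def)
    have "2 * \<nu> * (r z)\<^sup>2 > 0" using \<nu> pos by simp
    hence N: "N > 0" using N2 by (auto simp: N_def)
    \<comment> \<open>The slope \<open>N / (2 * r z)\<close> of \<open>r\<close> at \<open>z\<close>
      is at least \<open>sqrt (\<nu> / 2)\<close> and so beats the slope \<open>c\<close> of the
      penalty.\<close>
    have "(2 * c * r z)\<^sup>2 < N\<^sup>2"
    proof -
      have "4 * c\<^sup>2 * (r z)\<^sup>2 < 2 * \<nu> * (r z)\<^sup>2" using c pos by simp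
      thus ?thesis using N2 by (simp add: power_mult_distrib)
    qed
    hence lt: "2 * c * r z < N" using N by (auto intro: power_less_imp_less_base)
    \<comment> \<open>Half the critical length: the final contradiction works whenever
      \<open>t * M * N < 2 * (N - 2 * c * r z)\<close>.\<close>
    define t where "t = (N - 2 * c * r z) / (M * N)"
    have t: "t > 0" using lt M N by (simp add: t_def)
    have tM: "t * M * N = N - 2 * c * r z" using M N by (simp add: t_def)
    define y where "y = z - t *\<^sub>R G z"
    have "\<phi> y \<le> \<phi> z - t * N\<^sup>2 + M / 2 * (t * N)\<^sup>2"
      using lipschitz_gradient_upper[OF d lip, of z "- t *\<^sub>R G z"] t
      by (simp add: y_def N_def dot_square_norm)
    hence "t * N * (N - t * M * N / 2) \<le> (\<phi> z - m) - (\<phi> y - m)"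
      by (simp add: power2_eq_square algebra_simps)
    hence "t * N * (N - t * M * N / 2) \<le> (r z)\<^sup>2 - (r y)\<^sup>2" by (simp only: r0)
    hence low: "t * N * ((N + 2 * c * r z) / 2) \<le> (r z - r y) * (r z + r y)"
    proof -
      have "N - t * M * N / 2 = (N + 2 * c * r z) / 2" unfolding tM by (simp add: field_simps)
      moreover have "(r z)\<^sup>2 - (r y)\<^sup>2 = (r z - r y) * (r z + r y)"
        by (simp add: power2_eq_square algebra_simps)
      ultimately show ?thesis using \<open>t * N * (N - t * M * N / 2) \<le> (r z)\<^sup>2 - (r y)\<^sup>2\<close> by metis
    qed
    have "0 < t * N * ((N + 2 * c * r z) / 2)" using t N c pos by (simp add: add_pos_pos)
    hence "0 < (r z - r y) * (r z + r y)" using low by linarith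
    hence ry: "r y < r z" using pos r0(1)[of y] by (simp add: zero_less_mult_iff)
    have "\<Psi> z \<le> \<Psi> y" by (rule zmin)
    moreover have "norm (y - x) \<le> norm (z - x) + t * N"
      using norm_triangle_ineq4[of "z - x" "t *\<^sub>R G z"] t by (simp add: y_def N_def algebra_simps)
    hence "c * norm (y - x) \<le> c * (norm (z - x) + t * N)" using c by (intro mult_left_mono) auto
    ultimately have "r z - r y \<le> c * t * N" unfolding \<Psi>_def by (simp add: algebra_simps)
    hence "(r z - r y) * (r z + r y) \<le> (c * t * N) * (2 * r z)"
      using ry r0(1)[of y] c t N by (intro mult_mono) auto
    hence "(t * N) * ((N + 2 * c * r z) / 2) \<le> (t * N) * (2 * c * r z)"
      using low by (simp add: mult_ac)
    hence "(N + 2 * c * r z) / 2 \<le> 2 * c * r z" using t N by simp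
    thus False using lt by simp
  qed
  moreover have "c * norm (z - x) \<le> r x" using zx r0(1)[of z] by (simp add: \<Psi>_def)
  ultimately show ?thesis unfolding r_def by blast
qed

text \<open>The projection is at least as close as the minimiser just constructed, which gives the
  bound for every constant strictly below \<open>\<nu> / 2\<close>; a limit argument then reaches
  \<open>\<nu> / 2\<close> itself.\<close>

lemma PL_quadratic_growth:
  fixes \<phi> :: "'a::euclidean_space \<Rightarrow> real" and G :: "'a \<Rightarrow> 'a"
  assumes d: "\<And>z. (\<phi> has_derivative (\<lambda>h. G z \<bullet> h)) (at z)"
    and lip: "\<And>y z. norm (G y - G z) \<le> M * norm (y - z)" and M: "M > 0"
    and m: "\<And>z. m \<le> \<phi> z" and PL: "\<And>z. \<nu> * (\<phi> z - m) \<le> (norm (G z))\<^sup>2 / 2" and \<nu>: "\<nu> > 0"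
    and p: "is_proj {z. \<phi> z = m} x p"
  shows "\<nu> / 2 * (norm (x - p))\<^sup>2 \<le> \<phi> x - m"
proof (cases "x = p")
  case False
  have *: "C * (norm (x - p))\<^sup>2 \<le> \<phi> x - m" if C: "0 < C" "C < \<nu> / 2" for C
  proof -
    obtain z where z: "\<phi> z = m" "sqrt C * norm (z - x) \<le> sqrt (\<phi> x - m)"
      using PL_near_minimizer[OF d lip M m PL, of "sqrt C" x] C by auto
    have "(norm (x - p))\<^sup>2 \<le> (norm (x - z))\<^sup>2" using p z by (simp add: is_proj_def)
    hence "C * (norm (x - p))\<^sup>2 \<le> C * (norm (z - x))\<^sup>2"
      using C by (simp add: norm_minus_commute)
    also have "\<dots> = (sqrt C * norm (z - x))\<^sup>2" using C by (simp add: power_mult_distrib)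
    also have "\<dots> \<le> (sqrt (\<phi> x - m))\<^sup>2" using z C by (intro power_mono) auto
    also have "\<dots> = \<phi> x - m" using m by simp
    finally show ?thesis .
  qed
  have "\<nu> / 2 \<le> (\<phi> x - m) / (norm (x - p))\<^sup>2"
    by (rule dense_le_bounded[of 0]) (use \<nu> False * in \<open>auto simp: pos_le_divide_eq\<close>)
  thus ?thesis using False by (simp add: pos_le_divide_eq)
qed (use m in simp)

section \<open>Lyapunov descent\<close>

definition coord :: "real^'n \<Rightarrow> 'a \<Rightarrow> ('n::finite \<Rightarrow> 'a::real_inner) \<Rightarrow> real" where
  "coord b l z = (\<Sum>i\<in>UNIV. b$i * (z i \<bullet> l))"

lemma coord_add: "coord b l (\<lambda>i. z i + w i) = coord b l z + coord b l w"
  and coord_diff: "coord b l (\<lambda>i. z i - w i) = coord b l z - coord b l w"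
  and coord_scaleR: "coord b l (\<lambda>i. c *\<^sub>R z i) = c * coord b l z"
  by (simp_all add: coord_def inner_add_left inner_diff_left algebra_simps sum.distrib
      sum_subtractf sum_distrib_left)

lemma coord_symmetric_eigenvector:
  assumes sym: "\<And>i j. L$i$j = L$j$i" and eig: "L *v b = c *\<^sub>R b"
  shows "coord b l (\<lambda>i. \<Sum>j\<in>UNIV. L$i$j *\<^sub>R z j) = c * coord b l z"
proof -
  have "coord b l (\<lambda>i. \<Sum>j\<in>UNIV. L$i$j *\<^sub>R z j)
      = (\<Sum>i\<in>UNIV. \<Sum>j\<in>UNIV. b$i * (L$i$j * (z j \<bullet> l)))"
    by (simp add: coord_def inner_sum_left sum_distrib_left)
  also have "\<dots> = (\<Sum>j\<in>UNIV. \<Sum>i\<in>UNIV. b$i * (L$i$j * (z j \<bullet> l)))" by (rule sum.swap)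
  also have "\<dots> = (\<Sum>j\<in>UNIV. \<Sum>i\<in>UNIV. L$j$i * b$i * (z j \<bullet> l))"
  proof -
    have "b$i * (L$i$j * (z j \<bullet> l)) = L$j$i * b$i * (z j \<bullet> l)" for i j
      using sym[of i j] by simp
    thus ?thesis by (simp only:)
  qed
  also have "\<dots> = (\<Sum>j\<in>UNIV. (L *v b)$j * (z j \<bullet> l))"
    by (simp add: matrix_vector_mult_def sum_distrib_right)
  finally show ?thesis by (simp add: eig coord_def sum_distrib_left mult_ac)
qed

text \<open>The bias-variance decomposition: deviations from the mean sum to zero, so the cross term
  drops. The choice \<open>c = 0\<close> compares \<open>Knorm2\<close> and the mean with the full
  norm; the projected average as \<open>c\<close> gives the distance to the minimisers.\<close>

lemma sum_norm_shift:
  fixes z :: "'n::finite \<Rightarrow> 'a::real_inner"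
  shows "(\<Sum>i\<in>UNIV. (norm (z i - c))\<^sup>2) = Knorm2 z + real CARD('n) * (norm (avg z - c))\<^sup>2"
proof -
  let ?n = "real CARD('n)"
  have a: "(\<Sum>i\<in>UNIV. z i) = ?n *\<^sub>R avg z" by (simp add: avg_def)
  have "(norm (z i - c))\<^sup>2 = (norm (z i - avg z))\<^sup>2 + 2 * ((z i - avg z) \<bullet> (avg z - c))
      + (norm (avg z - c))\<^sup>2" for i
    by (simp add: dot_square_norm[symmetric] inner_diff_left inner_diff_right inner_commute algebra_simps)
  hence "(\<Sum>i\<in>UNIV. (norm (z i - c))\<^sup>2) = Knorm2 z + 2 * ((\<Sum>i\<in>UNIV. z i - avg z) \<bullet> (avg z - c))
      + ?n * (norm (avg z - c))\<^sup>2"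
    by (simp add: Knorm2_def sum.distrib inner_sum_left sum_distrib_left)
  moreover have "(\<Sum>i\<in>UNIV. z i - avg z) = 0"
    by (simp add: sum_subtractf a sum_constant_scaleR)
  ultimately show ?thesis by simp
qed

lemma Knorm2_nonneg: "0 \<le> Knorm2 z"
  by (simp add: Knorm2_def sum_nonneg)

lemma Knorm2_le: "Knorm2 z \<le> (\<Sum>i\<in>UNIV. (norm (z i))\<^sup>2)"
  using sum_norm_shift[of z 0] by simp

lemma norm_avg_le:
  fixes z :: "'n::finite \<Rightarrow> 'a::real_inner"
  shows "real CARD('n) * (norm (avg z))\<^sup>2 \<le> (\<Sum>i\<in>UNIV. (norm (z i))\<^sup>2)"
  using sum_norm_shift[of z 0] Knorm2_nonneg[of z] by simp

text \<open>Vectors in \<open>B\<close> have zero sum and do not see the mean, so each coordinate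
  direction \<open>l\<close> reduces to Parseval for the centred vector.\<close>

lemma coord_Parseval:
  fixes z :: "'n::finite \<Rightarrow> 'a::euclidean_space"
  assumes B: "pairwise orthogonal B" "\<And>b. b \<in> B \<Longrightarrow> norm b = 1"
    and sp: "span B = {u::real^'n. (\<Sum>i\<in>UNIV. u$i) = 0}"
  shows "(\<Sum>l\<in>Basis. \<Sum>b\<in>B. (coord b l z)\<^sup>2) = Knorm2 z"
proof -
  have "(\<Sum>b\<in>B. (coord b l z)\<^sup>2) = (\<Sum>i\<in>UNIV. ((z i - avg z) \<bullet> l)\<^sup>2)" for l
  proof -
    define u where "u = (\<chi> i. (z i - avg z) \<bullet> l)"
    have "(\<Sum>i\<in>UNIV. z i - avg z) = 0"
      by (simp add: sum_subtractf avg_def sum_constant_scaleR)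
    hence "(\<Sum>i\<in>UNIV. z i - avg z) \<bullet> l = 0" by simp
    hence "u \<in> span B" unfolding sp u_def by (simp add: inner_sum_left)
    hence "(\<Sum>b\<in>B. (b \<bullet> u)\<^sup>2) = (norm u)\<^sup>2" by (intro orthonormal_Parseval B)
    moreover have "b \<bullet> u = coord b l z" if "b \<in> B" for b
    proof -
      have "(\<Sum>i\<in>UNIV. b$i) = 0" using sp span_base[OF that] by auto
      hence "(\<Sum>i\<in>UNIV. b$i * (avg z \<bullet> l)) = 0" by (simp add: sum_distrib_right[symmetric])
      thus ?thesis
        by (simp add: inner_vec_def u_def coord_def inner_diff_left right_diff_distrib sum_subtractf)
    qed
    moreover have "(norm u)\<^sup>2 = (\<Sum>i\<in>UNIV. ((z i - avg z) \<bullet> l)\<^sup>2)"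
      unfolding dot_square_norm[symmetric] inner_vec_def by (simp add: u_def power2_eq_square)
    ultimately show ?thesis by simp
  qed
  hence "(\<Sum>l\<in>Basis. \<Sum>b\<in>B. (coord b l z)\<^sup>2) = (\<Sum>l\<in>Basis. \<Sum>i\<in>UNIV. ((z i - avg z) \<bullet> l)\<^sup>2)" by simp
  also have "\<dots> = (\<Sum>i\<in>UNIV. \<Sum>l\<in>Basis. ((z i - avg z) \<bullet> l)\<^sup>2)" by (rule sum.swap)
  also have "\<dots> = Knorm2 z"
    unfolding Knorm2_def dot_square_norm[symmetric] euclidean_inner[of "_ - _" "_ - _"] by (simp add: power2_eq_square)
  finally show ?thesis .
qed

text \<open>The uneven first split is fitted to the given constants: its 3/2 and the 3 of the second
  split add up to the 9/2 in front of \<open>Lf^2\<close> in \<open>eps1t\<close>, while its 3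
  reproduces \<open>noise\<close>.\<close>

lemma norm_add_sq_le:
  fixes a b c :: "'a::real_inner"
  shows "(norm (a + b))\<^sup>2 \<le> 3 / 2 * (norm a)\<^sup>2 + 3 * (norm b)\<^sup>2"
    and "(norm (a + b + c))\<^sup>2 \<le> 3 * ((norm a)\<^sup>2 + (norm b)\<^sup>2 + (norm c)\<^sup>2)"
proof -
  have "0 \<le> (a - 2 *\<^sub>R b) \<bullet> (a - 2 *\<^sub>R b)" by simp
  thus "(norm (a + b))\<^sup>2 \<le> 3 / 2 * (norm a)\<^sup>2 + 3 * (norm b)\<^sup>2"
    by (simp add: dot_square_norm[symmetric] inner_diff_left inner_diff_right inner_add_left
        inner_add_right inner_commute algebra_simps)
  have "0 \<le> (a - b) \<bullet> (a - b) + (b - c) \<bullet> (b - c) + (a - c) \<bullet> (a - c)" by simp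
  thus "(norm (a + b + c))\<^sup>2 \<le> 3 * ((norm a)\<^sup>2 + (norm b)\<^sup>2 + (norm c)\<^sup>2)"
    by (simp add: dot_square_norm[symmetric] inner_diff_left inner_diff_right inner_add_left
        inner_add_right inner_commute algebra_simps)
qed

text \<open>The step size bound \<open>eps5t / eps6t\<close> is designed for exactly this inequality.\<close>
lemma drift_absorbed:
  assumes "\<eta> > 0" "\<beta> > 0" "Lf > 0" "\<eta> * eps6t \<alpha> \<beta> Lf r2 \<le> eps5t \<alpha> \<beta> Lf r2"
  shows "drift_coeff \<alpha> \<beta> \<eta> r2 * (3 * Lf\<^sup>2 * \<eta>\<^sup>2) + Lf / 2 * \<eta>\<^sup>2 \<le> \<eta> / 8"
proof -
  have "drift_coeff \<alpha> \<beta> \<eta> r2 * (3 * Lf\<^sup>2 * \<eta>\<^sup>2) + Lf / 2 * \<eta>\<^sup>2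
      = \<eta> / 8 - \<eta> * (eps5t \<alpha> \<beta> Lf r2 - \<eta> * eps6t \<alpha> \<beta> Lf r2)"
  proof -
    define R where "R = 1 / r2"
    define a where "a = \<alpha> / \<beta>"
    have dc: "drift_coeff \<alpha> \<beta> \<eta> r2 = (1 / \<beta>\<^sup>2 + 1 / (2 * \<eta> * \<beta>)) * (R + a)
       + 1 / (2 * \<eta> * \<beta>\<^sup>2) + 1 / \<beta>\<^sup>2 + 1 / 2" by (simp add: drift_coeff_def R_def a_def)
    have e5: "eps5t \<alpha> \<beta> Lf r2 = 1 / 8 - 3 / (2 * \<beta>) * (1 / \<beta> + R + a) * Lf\<^sup>2"
      by (simp add: eps5t_def R_def a_def)
    have e6: "eps6t \<alpha> \<beta> Lf r2 = 3 / \<beta>\<^sup>2 * (1 + R + a) * Lf\<^sup>2 + Lf * (1 + 3 * Lf) / 2"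
      by (simp add: eps6t_def R_def a_def)
    show ?thesis unfolding dc e5 e6 using assms(1,2)
      by (simp add: power2_eq_square field_simps)
  qed
  also have "\<dots> \<le> \<eta> / 8" using assms by simp
  finally show ?thesis .
qed

text \<open>The hypotheses in the form the analysis uses. The Laplacian enters only through
  symmetry, vanishing column sums and an orthonormal eigenbasis of the zero-sum vectors with
  eigenvalues in \<open>[r2, r]\<close>; the step size bounds have their denominators
  cleared.\<close>

locale zeroth_order_primal_dual =
  fixes L :: "real^'n::finite^'n" and B :: "(real^'n) set" and lam :: "real^'n \<Rightarrow> real" and r r2 :: real
    and f :: "'n \<Rightarrow> 'a::euclidean_space \<Rightarrow> real" and g :: "'n \<Rightarrow> 'a \<Rightarrow> 'a"
    and F :: "'a \<Rightarrow> real" and gradF :: "'a \<Rightarrow> 'a"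
    and fstar Lf \<nu> \<alpha> \<beta> \<eta> :: real and x v :: "nat \<Rightarrow> 'n \<Rightarrow> 'a" and \<delta> :: "'n \<Rightarrow> nat \<Rightarrow> real"
  assumes L_sym: "\<And>i j. L$i$j = L$j$i" and L_zero: "\<And>j. (\<Sum>i\<in>UNIV. L$i$j) = 0"
    and B: "finite B" "pairwise orthogonal B" "\<And>b. b \<in> B \<Longrightarrow> norm b = 1"
      "span B = {u. (\<Sum>i\<in>UNIV. u$i) = 0}"
    and lam: "\<And>b. b \<in> B \<Longrightarrow> L *v b = lam b *\<^sub>R b" "\<And>b. b \<in> B \<Longrightarrow> r2 \<le> lam b \<and> lam b \<le> r"
    and r2_pos: "0 < r2"
    and F_def: "F = (\<lambda>z. (1 / real CARD('n)) * (\<Sum>i\<in>UNIV. f i z))"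
    and gradF_def: "gradF = (\<lambda>z. (1 / real CARD('n)) *\<^sub>R (\<Sum>i\<in>UNIV. g i z))"
    and fstar_le: "\<And>z. fstar \<le> F z"
    and f_deriv: "\<And>i z. (f i has_derivative (\<lambda>h. g i z \<bullet> h)) (at z)"
    and g_lipschitz: "\<And>i y z. norm (g i y - g i z) \<le> Lf * norm (y - z)" and Lf_pos: "Lf > 0"
    and nu_pos: "\<nu> > 0" and PL: "\<And>z. \<nu> * (F z - fstar) \<le> (norm (gradF z))\<^sup>2 / 2"
    and beta_pos: "\<beta> > 0" and alpha_gt: "\<alpha> > \<beta>" and eta_pos: "\<eta> > 0"
    and eta1: "\<eta> * eps2t \<alpha> \<beta> Lf r \<le> eps1t \<alpha> \<beta> Lf r2"
    and eta3: "\<eta> * eps4 \<beta> \<le> eps3 \<alpha> \<beta> r2"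
    and eta5: "\<eta> * eps6t \<alpha> \<beta> Lf r2 \<le> eps5t \<alpha> \<beta> Lf r2"
    and delta_pos: "\<And>i k. 0 < \<delta> i k"
    and v_start: "(\<Sum>j\<in>UNIV. v 0 j) = 0"
    and x_step: "\<And>k i. x (Suc k) i = x k i - \<eta> *\<^sub>R (\<alpha> *\<^sub>R (\<Sum>j\<in>UNIV. L$i$j *\<^sub>R x k j)
                      + \<beta> *\<^sub>R v k i + grad_est (f i) (x k i) (\<delta> i k))"
    and v_step: "\<And>k i. v (Suc k) i = v k i + (\<eta> * \<beta>) *\<^sub>R (\<Sum>j\<in>UNIV. L$i$j *\<^sub>R x k j)"
begin

definition "\<Delta> k = Max (range (\<lambda>i. \<delta> i k))"
definition "h k i = grad_est (f i) (x k i) (\<delta> i k)"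
text \<open>One common difference step for all agents, the largest of step \<open>k\<close>; at
  \<open>k = 0\<close> this is the vector in the initial value of the bound.\<close>

definition "h0 k i = grad_est (f i) (avg (x k)) (\<Delta> k)"
definition "w k i = v k i + (1 / \<beta>) *\<^sub>R h0 k i"
definition "gap k = real CARD('n) * (F (avg (x k)) - fstar)"
definition "quad k = (\<Sum>l\<in>Basis. \<Sum>b\<in>B. mode_energy \<alpha> \<beta> (lam b) (coord b l (x k)) (coord b l (w k)))"
definition "noise = 3 * real CARD('n) * real DIM('a) * Lf\<^sup>2 / 4"
text \<open>The squared step of the average up to scaling. It causes the drift of \<open>h0\<close>
  in \<open>est_drift\<close> and is paid for by its negative multiple in
  \<open>gap_descent\<close>.\<close>

definition "drive k = real CARD('n) * (norm (avg (h k)))\<^sup>2"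

section \<open>The average iterate, the estimator errors and the optimality gap\<close>

lemma \<Delta>: "\<delta> i k \<le> \<Delta> k" "0 < \<Delta> k"
proof -
  show *: "\<delta> i k \<le> \<Delta> k" for i unfolding \<Delta>_def by (rule Max_ge) auto
  show "0 < \<Delta> k" using *[of undefined] delta_pos[of undefined k] by linarith
qed

lemma sum_L:
  fixes z :: "'n \<Rightarrow> 'a"
  shows "(\<Sum>i\<in>UNIV. \<Sum>j\<in>UNIV. L$i$j *\<^sub>R z j) = 0"
proof -
  have "(\<Sum>i\<in>UNIV. \<Sum>j\<in>UNIV. L$i$j *\<^sub>R z j) = (\<Sum>j\<in>UNIV. (\<Sum>i\<in>UNIV. L$i$j) *\<^sub>R z j)"
    by (subst sum.swap) (simp add: scaleR_sum_left)
  thus ?thesis by (simp add: L_zero)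
qed

lemma sum_v: "(\<Sum>j\<in>UNIV. v k j) = 0"
  by (induction k) (simp_all add: v_start v_step sum.distrib scaleR_sum_right[symmetric] sum_L)

lemma avg_x_step: "avg (x (Suc k)) = avg (x k) - \<eta> *\<^sub>R avg (h k)"
proof -
  have "(\<Sum>i\<in>UNIV. x (Suc k) i) = (\<Sum>i\<in>UNIV. x k i) - \<eta> *\<^sub>R (\<Sum>i\<in>UNIV. h k i)"
    by (simp add: x_step h_def sum_subtractf sum.distrib scaleR_sum_right[symmetric] sum_L sum_v)
  thus ?thesis by (simp add: avg_def scaleR_diff_right)
qed

lemma gradF_avg: "gradF z = avg (\<lambda>i. g i z)"
  by (simp add: gradF_def avg_def)

lemma F_deriv: "(F has_derivative (\<lambda>h. gradF z \<bullet> h)) (at z)"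
  unfolding F_def gradF_def
  by (auto intro!: derivative_eq_intros f_deriv simp: inner_sum_left)

lemma gradF_lipschitz: "norm (gradF y - gradF z) \<le> Lf * norm (y - z)"
proof -
  have e: "gradF y - gradF z = avg (\<lambda>i. g i y - g i z)"
    by (simp add: gradF_avg avg_def sum_subtractf scaleR_diff_right)
  have "real CARD('n) * (norm (avg (\<lambda>i. g i y - g i z)))\<^sup>2 \<le> (\<Sum>i\<in>(UNIV::'n set). (norm (g i y - g i z))\<^sup>2)"
    by (rule norm_avg_le)
  also have "\<dots> \<le> real CARD('n) * (Lf * norm (y - z))\<^sup>2"
    by (rule sum_bounded_above) (intro power_mono g_lipschitz norm_ge_zero)
  finally have "(norm (gradF y - gradF z))\<^sup>2 \<le> (Lf * norm (y - z))\<^sup>2"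
    unfolding e by (rule mult_left_le_imp_le) simp
  thus ?thesis using Lf_pos by (auto intro: power2_le_imp_le)
qed

lemma est_error:
  "(norm (h k i - g i (x k i)))\<^sup>2 \<le> real DIM('a) * Lf\<^sup>2 * (\<Delta> k)\<^sup>2 / 4"
  "(norm (h0 k i - g i (avg (x k))))\<^sup>2 \<le> real DIM('a) * Lf\<^sup>2 * (\<Delta> k)\<^sup>2 / 4"
  unfolding h_def h0_def
  by (rule grad_est_error[OF f_deriv g_lipschitz]; use \<Delta> delta_pos Lf_pos in \<open>simp add: less_imp_le\<close>)+

lemma g_diff: "(norm (g i y - g i z))\<^sup>2 \<le> Lf\<^sup>2 * (norm (y - z))\<^sup>2"
  using power_mono[OF g_lipschitz norm_ge_zero, of i y z 2] by (simp add: power_mult_distrib)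

lemma sum_g_diff: "(\<Sum>i\<in>UNIV. (norm (g i (x k i) - g i (avg (x k))))\<^sup>2) \<le> Lf\<^sup>2 * Knorm2 (x k)"
  unfolding Knorm2_def sum_distrib_left by (intro sum_mono g_diff)

lemma est_consensus_error: "Knorm2 (\<lambda>i. h k i - h0 k i) \<le> 3 * Lf\<^sup>2 * Knorm2 (x k) + 2 * noise * (\<Delta> k)\<^sup>2"
proof -
  let ?d = "real DIM('a) * Lf\<^sup>2 * (\<Delta> k)\<^sup>2 / 4"
  have *: "(norm (h k i - h0 k i))\<^sup>2 \<le> 3 * (?d + (norm (g i (x k i) - g i (avg (x k))))\<^sup>2 + ?d)" for i
    using norm_add_sq_le(2)[of "h k i - g i (x k i)" "g i (x k i) - g i (avg (x k))" "g i (avg (x k)) - h0 k i"]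
      est_error[of k i] by (simp add: norm_minus_commute)
  have "Knorm2 (\<lambda>i. h k i - h0 k i)
      \<le> (\<Sum>i\<in>UNIV. 3 * (?d + (norm (g i (x k i) - g i (avg (x k))))\<^sup>2 + ?d))"
    by (rule order.trans[OF Knorm2_le], rule sum_mono, rule *)
  also have "\<dots> = 3 * (\<Sum>i\<in>UNIV. (norm (g i (x k i) - g i (avg (x k))))\<^sup>2) + 2 * noise * (\<Delta> k)\<^sup>2"
    by (simp add: sum.distrib sum_distrib_left noise_def algebra_simps)
  finally show ?thesis using sum_g_diff[of k] by simp
qed

lemma est_drift: "Knorm2 (\<lambda>i. h0 (Suc k) i - h0 k i)
    \<le> 3 * Lf\<^sup>2 * \<eta>\<^sup>2 * drive k + noise * ((\<Delta> k)\<^sup>2 + (\<Delta> (Suc k))\<^sup>2)"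
proof -
  let ?d = "\<lambda>k. real DIM('a) * Lf\<^sup>2 * (\<Delta> k)\<^sup>2 / 4"
  have *: "(norm (h0 (Suc k) i - h0 k i))\<^sup>2
      \<le> 3 * (?d (Suc k) + Lf\<^sup>2 * (\<eta>\<^sup>2 * (norm (avg (h k)))\<^sup>2) + ?d k)" for i
    using norm_add_sq_le(2)[of "h0 (Suc k) i - g i (avg (x (Suc k)))"
        "g i (avg (x (Suc k))) - g i (avg (x k))" "g i (avg (x k)) - h0 k i"]
      est_error(2)[of k i] est_error(2)[of "Suc k" i] g_diff[of i "avg (x (Suc k))" "avg (x k)"]
    by (simp add: norm_minus_commute avg_x_step power_mult_distrib)
  have "Knorm2 (\<lambda>i. h0 (Suc k) i - h0 k i)
      \<le> (\<Sum>i\<in>(UNIV::'n set). 3 * (?d (Suc k) + Lf\<^sup>2 * (\<eta>\<^sup>2 * (norm (avg (h k)))\<^sup>2) + ?d k))"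
    by (rule order.trans[OF Knorm2_le], rule sum_mono, rule *)
  also have "\<dots> = 3 * Lf\<^sup>2 * \<eta>\<^sup>2 * drive k + noise * ((\<Delta> k)\<^sup>2 + (\<Delta> (Suc k))\<^sup>2)"
    by (simp add: noise_def drive_def algebra_simps)
  finally show ?thesis .
qed

lemma gap_nonneg: "0 \<le> gap k"
  using fstar_le by (simp add: gap_def)

text \<open>Polarisation splits the inner product of the true and the estimated mean gradient into
  three squares. The true gradient pays for the contraction through the Polyak-Lojasiewicz
  inequality, the estimate is kept as \<open>drive\<close>, and their difference is consensus error
  plus noise.\<close>

lemma gap_descent:
  "gap (Suc k) \<le> gap k + \<eta> / 2 * (3 / 2 * Lf\<^sup>2 * Knorm2 (x k) + noise * (\<Delta> k)\<^sup>2)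
     - \<eta> / 2 * drive k - \<eta> * \<nu> * gap k + Lf / 2 * \<eta>\<^sup>2 * drive k"
proof -
  let ?n = "real CARD('n)" and ?G = "gradF (avg (x k))" and ?H = "avg (h k)"
  let ?d = "real DIM('a) * Lf\<^sup>2 * (\<Delta> k)\<^sup>2 / 4"
  have "F (avg (x (Suc k))) \<le> F (avg (x k)) + ?G \<bullet> (- \<eta> *\<^sub>R ?H) + Lf / 2 * (norm (- \<eta> *\<^sub>R ?H))\<^sup>2"
    using lipschitz_gradient_upper[OF F_deriv gradF_lipschitz, of "avg (x k)" "- \<eta> *\<^sub>R ?H"]
    by (simp add: avg_x_step)
  hence "F (avg (x (Suc k))) \<le> F (avg (x k)) - \<eta> * (?G \<bullet> ?H) + Lf / 2 * \<eta>\<^sup>2 * (norm ?H)\<^sup>2"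
    by (simp add: power_mult_distrib)
  moreover have "?G \<bullet> ?H = ((norm ?G)\<^sup>2 + (norm ?H)\<^sup>2 - (norm (?H - ?G))\<^sup>2) / 2"
    by (simp add: dot_square_norm[symmetric] inner_diff_left inner_diff_right inner_commute)
  moreover have "\<eta> * (\<nu> * (F (avg (x k)) - fstar)) \<le> \<eta> * ((norm ?G)\<^sup>2 / 2)"
    using PL eta_pos by (intro mult_left_mono) auto
  ultimately have "F (avg (x (Suc k))) \<le> F (avg (x k)) + \<eta> / 2 * (norm (?H - ?G))\<^sup>2
      - \<eta> / 2 * (norm ?H)\<^sup>2 - \<eta> * \<nu> * (F (avg (x k)) - fstar) + Lf / 2 * \<eta>\<^sup>2 * (norm ?H)\<^sup>2"
    by (simp add: algebra_simps add_divide_distrib diff_divide_distrib)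
  hence "?n * (F (avg (x (Suc k))) - fstar) \<le> ?n * (F (avg (x k)) + \<eta> / 2 * (norm (?H - ?G))\<^sup>2
      - \<eta> / 2 * (norm ?H)\<^sup>2 - \<eta> * \<nu> * (F (avg (x k)) - fstar) + Lf / 2 * \<eta>\<^sup>2 * (norm ?H)\<^sup>2 - fstar)"
    by (intro mult_left_mono) auto
  hence "gap (Suc k) \<le> gap k + \<eta> / 2 * (?n * (norm (?H - ?G))\<^sup>2)
     - \<eta> / 2 * drive k - \<eta> * \<nu> * gap k + Lf / 2 * \<eta>\<^sup>2 * drive k"
    unfolding gap_def drive_def by (simp add: algebra_simps)
  moreover have "?n * (norm (?H - ?G))\<^sup>2 \<le> 3 / 2 * Lf\<^sup>2 * Knorm2 (x k) + noise * (\<Delta> k)\<^sup>2"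
  proof -
    have "?H - ?G = avg (\<lambda>i. h k i - g i (avg (x k)))"
      by (simp add: gradF_avg avg_def sum_subtractf scaleR_diff_right)
    hence "?n * (norm (?H - ?G))\<^sup>2 \<le> (\<Sum>i\<in>UNIV. (norm (h k i - g i (avg (x k))))\<^sup>2)"
      by (metis norm_avg_le)
    also have "\<dots> \<le> (\<Sum>i\<in>UNIV. 3 / 2 * (norm (g i (x k i) - g i (avg (x k))))\<^sup>2 + 3 * ?d)"
    proof (rule sum_mono)
      show "(norm (h k i - g i (avg (x k))))\<^sup>2 \<le> 3 / 2 * (norm (g i (x k i) - g i (avg (x k))))\<^sup>2 + 3 * ?d" for i
        using norm_add_sq_le(1)[of "g i (x k i) - g i (avg (x k))" "h k i - g i (x k i)"] est_error(1)[of k i]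
        by (simp add: algebra_simps)
    qed
    also have "\<dots> = 3 / 2 * (\<Sum>i\<in>UNIV. (norm (g i (x k i) - g i (avg (x k))))\<^sup>2) + noise * (\<Delta> k)\<^sup>2"
      by (simp add: sum.distrib sum_distrib_left noise_def algebra_simps)
    also have "\<dots> \<le> 3 / 2 * (Lf\<^sup>2 * Knorm2 (x k)) + noise * (\<Delta> k)\<^sup>2" using sum_g_diff[of k] by simp
    finally show ?thesis by simp
  qed
  hence "\<eta> / 2 * (?n * (norm (?H - ?G))\<^sup>2)
      \<le> \<eta> / 2 * (3 / 2 * Lf\<^sup>2 * Knorm2 (x k) + noise * (\<Delta> k)\<^sup>2)"
    using eta_pos by (intro mult_left_mono) auto
  ultimately show ?thesis by linarith
qed

section \<open>Consensus energy and the full Lyapunov function along the algorithm\<close>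

lemmas Parseval = coord_Parseval[OF B(2-4)]

lemma coord_step:
  assumes "b \<in> B"
  defines "y \<equiv> \<lambda>k l. coord b l (x k)" and "c \<equiv> \<lambda>k l. coord b l (w k)"
  shows "y (Suc k) l = y k l - \<eta> * (\<alpha> * lam b * y k l + \<beta> * c k l + coord b l (\<lambda>i. h k i - h0 k i))"
    and "c (Suc k) l = c k l + \<eta> * \<beta> * lam b * y k l + coord b l (\<lambda>i. h0 (Suc k) i - h0 k i) / \<beta>"
proof -
  note eig = coord_symmetric_eigenvector[OF L_sym lam(1)[OF assms(1)]]
  have cw: "c k l = coord b l (v k) + coord b l (h0 k) / \<beta>" for k
    unfolding c_def w_def by (simp add: coord_add coord_scaleR)
  have "y (Suc k) l = y k l - \<eta> * (\<alpha> * (lam b * y k l) + \<beta> * coord b l (v k) + coord b l (h k))"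
    unfolding y_def x_step h_def[symmetric] by (simp add: coord_add coord_diff coord_scaleR eig)
  moreover have "\<beta> * c k l + coord b l (\<lambda>i. h k i - h0 k i) = \<beta> * coord b l (v k) + coord b l (h k)"
    using beta_pos by (simp add: cw coord_diff distrib_left)
  ultimately show "y (Suc k) l = y k l - \<eta> * (\<alpha> * lam b * y k l + \<beta> * c k l + coord b l (\<lambda>i. h k i - h0 k i))"
    by (simp add: add.assoc mult.assoc)
  have "coord b l (v (Suc k)) = coord b l (v k) + \<eta> * \<beta> * (lam b * y k l)"
    unfolding y_def v_step by (simp add: coord_add coord_scaleR eig)
  thus "c (Suc k) l = c k l + \<eta> * \<beta> * lam b * y k l + coord b l (\<lambda>i. h0 (Suc k) i - h0 k i) / \<beta>"
    by (simp add: cw coord_diff diff_divide_distrib)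
qed

lemma quad_descent:
  "quad (Suc k) \<le> quad k
     - \<eta> * ((\<alpha> - \<beta>) * r2 - 1 - \<eta> * (\<beta>\<^sup>2 * r + (2 * \<alpha>\<^sup>2 + \<beta>\<^sup>2) * r\<^sup>2)) * Knorm2 (x k)
     - \<eta> * (eps3 \<alpha> \<beta> r2 - \<eta> * eps4 \<beta>) * Knorm2 (w k)
     + (\<eta> + 5 / 2 * \<eta>\<^sup>2) * Knorm2 (\<lambda>i. h k i - h0 k i)
     + drift_coeff \<alpha> \<beta> \<eta> r2 * Knorm2 (\<lambda>i. h0 (Suc k) i - h0 k i)"
proof -
  have "quad (Suc k) \<le> (\<Sum>l\<in>Basis. \<Sum>b\<in>B.
      mode_energy \<alpha> \<beta> (lam b) (coord b l (x k)) (coord b l (w k))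
      - \<eta> * ((\<alpha> - \<beta>) * r2 - 1 - \<eta> * (\<beta>\<^sup>2 * r + (2 * \<alpha>\<^sup>2 + \<beta>\<^sup>2) * r\<^sup>2)) * (coord b l (x k))\<^sup>2
      - \<eta> * (eps3 \<alpha> \<beta> r2 - \<eta> * eps4 \<beta>) * (coord b l (w k))\<^sup>2
      + (\<eta> + 5 / 2 * \<eta>\<^sup>2) * (coord b l (\<lambda>i. h k i - h0 k i))\<^sup>2
      + drift_coeff \<alpha> \<beta> \<eta> r2 * (coord b l (\<lambda>i. h0 (Suc k) i - h0 k i))\<^sup>2)"
    unfolding quad_def
  proof (intro sum_mono, goal_cases)
    case (1 l b)
    show ?case unfolding coord_step[OF 1(2)]
      using 1(2) lam(2) r2_pos by (intro mode_energy_descent beta_pos alpha_gt eta_pos) auto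
  qed
  also have "\<dots> = quad k
     - \<eta> * ((\<alpha> - \<beta>) * r2 - 1 - \<eta> * (\<beta>\<^sup>2 * r + (2 * \<alpha>\<^sup>2 + \<beta>\<^sup>2) * r\<^sup>2)) * Knorm2 (x k)
     - \<eta> * (eps3 \<alpha> \<beta> r2 - \<eta> * eps4 \<beta>) * Knorm2 (w k)
     + (\<eta> + 5 / 2 * \<eta>\<^sup>2) * Knorm2 (\<lambda>i. h k i - h0 k i)
     + drift_coeff \<alpha> \<beta> \<eta> r2 * Knorm2 (\<lambda>i. h0 (Suc k) i - h0 k i)"
    by (simp only: sum.distrib sum_subtractf sum_distrib_left[symmetric] Parseval quad_def)
  finally show ?thesis .
qed

lemma quad_lower: "(1 - 1 / (1 / r + \<alpha> / \<beta>)) / 2 * Knorm2 (x k) \<le> quad k"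
proof -
  have "(\<Sum>l\<in>Basis. \<Sum>b\<in>B. (1 - 1 / (1 / r + \<alpha> / \<beta>)) / 2 * (coord b l (x k))\<^sup>2) \<le> quad k"
    unfolding quad_def
  proof (intro sum_mono, goal_cases)
    case (1 l b)
    show ?case using lam(2)[OF 1(2)] r2_pos by (intro mode_energy_lower beta_pos alpha_gt) auto
  qed
  thus ?thesis by (simp only: sum_distrib_left[symmetric] Parseval)
qed

lemma quad_upper: "quad k \<le> eps8 \<alpha> \<beta> r2 * (Knorm2 (x k) + Knorm2 (w k))"
proof -
  have "quad k \<le> (\<Sum>l\<in>Basis. \<Sum>b\<in>B. eps8 \<alpha> \<beta> r2 * ((coord b l (x k))\<^sup>2 + (coord b l (w k))\<^sup>2))"
    unfolding quad_def
  proof (intro sum_mono, goal_cases)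
    case (1 l b)
    show ?case using lam(2)[OF 1(2)] r2_pos by (intro mode_energy_upper beta_pos alpha_gt) auto
  qed
  thus ?thesis by (simp only: sum_distrib_left[symmetric] sum.distrib Parseval)
qed

lemma lyapunov_descent:
  fixes \<theta> :: real
  assumes \<theta>: "1 \<le> \<theta>" "\<theta> \<le> 2"
  shows "quad (Suc k) + \<theta> * gap (Suc k) \<le> quad k + \<theta> * gap k
     - eps10t \<alpha> \<beta> \<eta> Lf r r2 \<nu> * (Knorm2 (x k) + Knorm2 (w k) + gap k)
     + eps11 \<alpha> \<beta> \<eta> Lf r2 (real CARD('n)) (real DIM('a)) * (\<Delta> k)\<^sup>2
     + eps12 \<alpha> \<beta> \<eta> Lf r2 (real CARD('n)) (real DIM('a)) * (\<Delta> (Suc k))\<^sup>2"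
proof -
  define D where "D = drift_coeff \<alpha> \<beta> \<eta> r2"
  define Y where "Y = Knorm2 (x k)"
  define W where "W = Knorm2 (w k)"
  define H where "H = drive k"
  define m where "m = min (min (eps1t \<alpha> \<beta> Lf r2 - \<eta> * eps2t \<alpha> \<beta> Lf r) (eps3 \<alpha> \<beta> r2 - \<eta> * eps4 \<beta>)) (\<nu> / 4)"
  have nn: "0 \<le> Y" "0 \<le> W" "0 \<le> H" "0 \<le> noise" "0 \<le> gap k"
    using gap_nonneg by (simp_all add: Y_def W_def H_def Knorm2_nonneg drive_def noise_def)
  have "1 / r2 > 0" "\<alpha> / \<beta> > 0" using r2_pos beta_pos alpha_gt by auto
  hence D0: "D \<ge> 0" unfolding D_def drift_coeff_def using beta_pos eta_pos
    by (intro add_nonneg_nonneg mult_nonneg_nonneg) auto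
  have e12: "eps12 \<alpha> \<beta> \<eta> Lf r2 (real CARD('n)) (real DIM('a)) = D * noise"
    by (simp add: eps12_def D_def drift_coeff_def noise_def)
  have e11: "eps11 \<alpha> \<beta> \<eta> Lf r2 (real CARD('n)) (real DIM('a)) = (15 * \<eta> / 4 + 5 * \<eta>\<^sup>2) * noise + D * noise"
    unfolding eps11_def e12 by (simp add: noise_def)
  have q: "quad (Suc k) \<le> quad k
     - \<eta> * ((\<alpha> - \<beta>) * r2 - 1 - \<eta> * (\<beta>\<^sup>2 * r + (2 * \<alpha>\<^sup>2 + \<beta>\<^sup>2) * r\<^sup>2)) * Y
     - \<eta> * (eps3 \<alpha> \<beta> r2 - \<eta> * eps4 \<beta>) * W
     + (\<eta> + 5 / 2 * \<eta>\<^sup>2) * (3 * Lf\<^sup>2 * Y + 2 * noise * (\<Delta> k)\<^sup>2)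
     + D * (3 * Lf\<^sup>2 * \<eta>\<^sup>2 * H + noise * ((\<Delta> k)\<^sup>2 + (\<Delta> (Suc k))\<^sup>2))"
  proof -
    have "(\<eta> + 5 / 2 * \<eta>\<^sup>2) * Knorm2 (\<lambda>i. h k i - h0 k i)
       \<le> (\<eta> + 5 / 2 * \<eta>\<^sup>2) * (3 * Lf\<^sup>2 * Y + 2 * noise * (\<Delta> k)\<^sup>2)"
      using est_consensus_error[of k] eta_pos unfolding Y_def by (intro mult_left_mono) auto
    moreover have "D * Knorm2 (\<lambda>i. h0 (Suc k) i - h0 k i)
       \<le> D * (3 * Lf\<^sup>2 * \<eta>\<^sup>2 * H + noise * ((\<Delta> k)\<^sup>2 + (\<Delta> (Suc k))\<^sup>2))"
      using est_drift[of k] D0 unfolding H_def by (intro mult_left_mono) auto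
    ultimately show ?thesis using quad_descent[of k] unfolding Y_def W_def D_def by linarith
  qed
  have "\<theta> * gap (Suc k) \<le> \<theta> * (gap k + \<eta> / 2 * (3 / 2 * Lf\<^sup>2 * Y + noise * (\<Delta> k)\<^sup>2)
     - \<eta> / 2 * H - \<eta> * \<nu> * gap k + Lf / 2 * \<eta>\<^sup>2 * H)"
    using gap_descent[of k] \<theta> unfolding Y_def H_def by (intro mult_left_mono) auto
  also have "\<dots> = \<theta> * gap k + \<theta> * (\<eta> / 2 * (3 / 2 * Lf\<^sup>2 * Y + noise * (\<Delta> k)\<^sup>2))
     - \<theta> * ((\<eta> / 2 - Lf / 2 * \<eta>\<^sup>2) * H) - \<theta> * (\<eta> * \<nu> * gap k)" by (simp add: algebra_simps)
  \<comment> \<open>Positive errors use \<open>\<theta> \<le> 2\<close>, negative terms use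
    \<open>1 \<le> \<theta>\<close>. The latter needs a nonnegative coefficient of \<open>H\<close>,
    which \<open>drift_absorbed\<close> provides.\<close>
  also have "\<dots> \<le> \<theta> * gap k + 2 * (\<eta> / 2 * (3 / 2 * Lf\<^sup>2 * Y + noise * (\<Delta> k)\<^sup>2))
     - 1 * ((\<eta> / 2 - Lf / 2 * \<eta>\<^sup>2) * H) - 1 * (\<eta> * \<nu> * gap k)"
  proof -
    have "0 \<le> D * (3 * Lf\<^sup>2 * \<eta>\<^sup>2)" using D0 by simp
    hence "Lf / 2 * \<eta>\<^sup>2 \<le> \<eta> / 8"
      using drift_absorbed[OF eta_pos beta_pos Lf_pos eta5] unfolding D_def by linarith
    hence "0 \<le> \<eta> / 2 - Lf / 2 * \<eta>\<^sup>2" using eta_pos by linarith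
    thus ?thesis using \<theta> nn eta_pos nu_pos by (intro diff_mono add_left_mono mult_right_mono) auto
  qed
  finally have p: "\<theta> * gap (Suc k) \<le> \<theta> * gap k + \<eta> * (3 / 2 * Lf\<^sup>2 * Y + noise * (\<Delta> k)\<^sup>2)
     - (\<eta> / 2 - Lf / 2 * \<eta>\<^sup>2) * H - \<eta> * \<nu> * gap k" by simp
  have "(D * (3 * Lf\<^sup>2 * \<eta>\<^sup>2) + Lf / 2 * \<eta>\<^sup>2) * H \<le> \<eta> / 2 * H"
    using drift_absorbed[OF eta_pos beta_pos Lf_pos eta5] eta_pos nn unfolding D_def
    by (intro mult_right_mono) auto
  hence hH: "D * (3 * Lf\<^sup>2 * \<eta>\<^sup>2 * H) - (\<eta> / 2 - Lf / 2 * \<eta>\<^sup>2) * H \<le> 0" by (simp add: algebra_simps)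
  \<comment> \<open>Noise of step \<open>k\<close> accumulates as
    \<open>2 * \<eta> + 5 * \<eta>^2\<close> from the consensus error and \<eta> from the gap;
    \<open>eps11\<close> has room for more.\<close>
  have hN: "(3 * \<eta> + 5 * \<eta>\<^sup>2) * (noise * (\<Delta> k)\<^sup>2) \<le> (15 * \<eta> / 4 + 5 * \<eta>\<^sup>2) * (noise * (\<Delta> k)\<^sup>2)"
    using eta_pos nn by (intro mult_right_mono) auto
  have hY: "\<eta> * m * Y \<le> \<eta> * (eps1t \<alpha> \<beta> Lf r2 - \<eta> * eps2t \<alpha> \<beta> Lf r) * Y"
    and hW: "\<eta> * m * W \<le> \<eta> * (eps3 \<alpha> \<beta> r2 - \<eta> * eps4 \<beta>) * W"
    and hP: "\<eta> * m * gap k \<le> \<eta> * \<nu> * gap k"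
    using eta_pos nn nu_pos by (intro mult_right_mono mult_left_mono; simp add: m_def)+
  \<comment> \<open>Origin of the constants: in \<open>eps1t\<close> the 1 comes from the Young
    splits and \<open>9 / 2 = 3 + 3 / 2\<close> from the estimator difference and the gap; in
    \<open>eps2t\<close> the 15/2 is \<open>5 / 2 * 3\<close>.\<close>
  have "\<eta> * (eps1t \<alpha> \<beta> Lf r2 - \<eta> * eps2t \<alpha> \<beta> Lf r) * Y
     = \<eta> * ((\<alpha> - \<beta>) * r2 - 1 - \<eta> * (\<beta>\<^sup>2 * r + (2 * \<alpha>\<^sup>2 + \<beta>\<^sup>2) * r\<^sup>2)) * Y
       - (\<eta> + 5 / 2 * \<eta>\<^sup>2) * (3 * Lf\<^sup>2 * Y) - \<eta> * (3 / 2 * Lf\<^sup>2 * Y)"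
    unfolding eps1t_def eps2t_def by (simp add: algebra_simps power2_eq_square add_divide_distrib)
  moreover have e10: "eps10t \<alpha> \<beta> \<eta> Lf r r2 \<nu> = \<eta> * m" by (simp add: eps10t_def m_def)
  moreover have "(\<eta> + 5 / 2 * \<eta>\<^sup>2) * (3 * Lf\<^sup>2 * Y + 2 * noise * (\<Delta> k)\<^sup>2)
      = (\<eta> + 5 / 2 * \<eta>\<^sup>2) * (3 * Lf\<^sup>2 * Y) + (3 * \<eta> + 5 * \<eta>\<^sup>2) * (noise * (\<Delta> k)\<^sup>2)
        - \<eta> * (noise * (\<Delta> k)\<^sup>2)"
    and "D * (3 * Lf\<^sup>2 * \<eta>\<^sup>2 * H + noise * ((\<Delta> k)\<^sup>2 + (\<Delta> (Suc k))\<^sup>2))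
      = D * (3 * Lf\<^sup>2 * \<eta>\<^sup>2 * H) + D * noise * (\<Delta> k)\<^sup>2 + D * noise * (\<Delta> (Suc k))\<^sup>2"
    and "\<eta> * (3 / 2 * Lf\<^sup>2 * Y + noise * (\<Delta> k)\<^sup>2) = \<eta> * (3 / 2 * Lf\<^sup>2 * Y) + \<eta> * (noise * (\<Delta> k)\<^sup>2)"
    and "((15 * \<eta> / 4 + 5 * \<eta>\<^sup>2) * noise + D * noise) * (\<Delta> k)\<^sup>2
      = (15 * \<eta> / 4 + 5 * \<eta>\<^sup>2) * (noise * (\<Delta> k)\<^sup>2) + D * noise * (\<Delta> k)\<^sup>2"
    and "\<eta> * m * (Y + W + gap k) = \<eta> * m * Y + \<eta> * m * W + \<eta> * m * gap k"
    by (simp_all add: algebra_simps)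
  ultimately show ?thesis
    using q p hH hN hY hW hP unfolding e10 e11 e12 Y_def[symmetric] W_def[symmetric] by linarith
qed

end

section \<open>Linear convergence\<close>

theorem theorem4:
  fixes A L :: "real^'n::finite^'n"
    and f :: "'n \<Rightarrow> 'a::euclidean_space \<Rightarrow> real"
    and g :: "'n \<Rightarrow> 'a \<Rightarrow> 'a"
    and F :: "'a \<Rightarrow> real" and gradF :: "'a \<Rightarrow> 'a"
    and fstar Lf \<nu> \<kappa>2 \<alpha> \<beta> \<eta> eh eb :: real
    and x v :: "nat \<Rightarrow> 'n \<Rightarrow> 'a"
    and \<delta> :: "'n \<Rightarrow> nat \<Rightarrow> real"
  assumes n2: "CARD('n) \<ge> 2"
    and adj: "weighted_adjacency A" and L_def: "L = laplacian A"
    and A1: "graph_connected A"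
    and F_def: "F = (\<lambda>z. (1 / real CARD('n)) * (\<Sum>i\<in>UNIV. f i z))"
    and gradF_def: "gradF = (\<lambda>z. (1 / real CARD('n)) *\<^sub>R (\<Sum>i\<in>UNIV. g i z))"
    and A2: "\<forall>z. fstar \<le> F z" "\<exists>z. F z = fstar"
    and A3: "\<forall>i z. (f i has_derivative (\<lambda>h. g i z \<bullet> h)) (at z)"
            "\<forall>i y z. norm (g i y - g i z) \<le> Lf * norm (y - z)" "Lf > 0"
    and A4: "\<nu> > 0" "\<forall>z. (1 / 2) * (norm (gradF z))\<^sup>2 \<ge> \<nu> * (F z - fstar)"
    and k2: "\<kappa>2 > 1"
    and beta: "\<beta> > max (max (kappa1t Lf (rho2 L) / (\<kappa>2 - 1)) (kappa3 \<kappa>2 (rho2 L)))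
                        (kappa4t Lf \<kappa>2 (rho2 L))"
    and alpha: "\<beta> + kappa1t Lf (rho2 L) < \<alpha>" "\<alpha> \<le> \<kappa>2 * \<beta>"
    and eta: "0 < \<eta>"
      "\<eta> < min (min (eps1t \<alpha> \<beta> Lf (rho2 L) / eps2t \<alpha> \<beta> Lf (rho L))
                    (eps3 \<alpha> \<beta> (rho2 L) / eps4 \<beta>))
               (eps5t \<alpha> \<beta> Lf (rho2 L) / eps6t \<alpha> \<beta> Lf (rho2 L))"
    and eh: "0 < eh" "eh < 1" and eb: "eh < eb" "eb < 1"
    and delta: "\<forall>i k. 0 < \<delta> i k \<and> \<delta> i k \<le> eh powr (real k / 2)"
    and v0: "(\<Sum>j\<in>UNIV. v 0 j) = 0"
    and x_upd: "\<forall>k i. x (Suc k) i = x k i - \<eta> *\<^sub>R (\<alpha> *\<^sub>R (\<Sum>j\<in>UNIV. L$i$j *\<^sub>R x k j)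
                      + \<beta> *\<^sub>R v k i + grad_est (f i) (x k i) (\<delta> i k))"
    and v_upd: "\<forall>k i. v (Suc k) i = v k i + (\<eta> * \<beta>) *\<^sub>R (\<Sum>j\<in>UNIV. L$i$j *\<^sub>R x k j)"
  shows
    "let n = real CARD('n); p = real DIM('a); r = rho L; r2 = rho2 L;
         e8 = eps8 \<alpha> \<beta> r2; e9 = eps9 \<alpha> \<beta> r;
         e11 = eps11 \<alpha> \<beta> \<eta> Lf r2 n p; e12 = eps12 \<alpha> \<beta> \<eta> Lf r2 n p;
         et = eps10t \<alpha> \<beta> \<eta> Lf r r2 \<nu> / e8;
         \<delta>0 = Max (range (\<lambda>i. \<delta> i 0));
         h0 = (\<lambda>i. grad_est (f i) (avg (x 0)) \<delta>0);
         U0 = Knorm2 (x 0) + Knorm2 (\<lambda>i. v 0 i + (1 / \<beta>) *\<^sub>R h0 i)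
              + n * (F (avg (x 0)) - fstar);
         B = (\<lambda>k. (1 - et) ^ (k + 1) * e8 * U0 + phi e11 e12 et eh eb k);
         Xs = {z. F z = fstar}
     in (\<forall>k. (\<Sum>i\<in>UNIV. (norm (x k i - avg (x k)))\<^sup>2) + n * (F (avg (x k)) - fstar)
             \<le> (1 / e9) * B k)
      \<and> ((\<forall>z. \<exists>!y. is_proj Xs z y) \<longrightarrow>
           (\<forall>k. (\<Sum>i\<in>UNIV. (norm (x k i - proj Xs (avg (x k))))\<^sup>2)
                 \<le> (1 / e9) * (1 + 1 / (2 * \<nu>)) * B k))"
proof -
  define n where "n = real CARD('n)"
  define p where "p = real DIM('a)"
  define r where "r = rho L"
  define r2 where "r2 = rho2 L"
  define e8 where "e8 = eps8 \<alpha> \<beta> r2"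
  define e9 where "e9 = eps9 \<alpha> \<beta> r"
  define e11 where "e11 = eps11 \<alpha> \<beta> \<eta> Lf r2 n p"
  define e12 where "e12 = eps12 \<alpha> \<beta> \<eta> Lf r2 n p"
  define u where "u = eps10t \<alpha> \<beta> \<eta> Lf r r2 \<nu>"
  define et where "et = u / e8"
  define U0 where "U0 = Knorm2 (x 0) + Knorm2 (\<lambda>i. v 0 i + (1 / \<beta>) *\<^sub>R
      grad_est (f i) (avg (x 0)) (Max (range (\<lambda>i. \<delta> i 0)))) + n * (F (avg (x 0)) - fstar)"
  define bound where "bound k = (1 - et) ^ (k + 1) * e8 * U0 + phi e11 e12 et eh eb k" for k
  obtain B lam where eb': "finite B" "pairwise orthogonal B" "\<And>b. b \<in> B \<Longrightarrow> norm b = 1"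
    "span B = {u. (\<Sum>i\<in>UNIV. u$i) = 0}" "\<And>b. b \<in> B \<Longrightarrow> L *v b = lam b *\<^sub>R b"
    "\<And>b. b \<in> B \<Longrightarrow> r2 \<le> lam b \<and> lam b \<le> r" and r2: "0 < r2" "r2 \<le> r"
    using laplacian_eigenbasis[OF adj A1 n2] unfolding r_def r2_def L_def by metis
  have r: "r > 0" using r2 by linarith
  have k1: "kappa1t Lf r2 > 0" using A3(3) r2 by (simp add: kappa1t_def add_pos_nonneg)
  have beta_pos: "\<beta> > 0"
  proof -
    have "0 < kappa1t Lf r2 / (\<kappa>2 - 1)" using k1 k2 by simp
    thus ?thesis using beta unfolding r2_def by linarith
  qed
  have alpha_gt: "\<alpha> > \<beta>" using alpha(1) k1 unfolding r2_def by linarith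
  have pos: "0 < eps2t \<alpha> \<beta> Lf r" "0 < eps4 \<beta>" "0 < eps6t \<alpha> \<beta> Lf r2"
  proof -
    show "0 < eps2t \<alpha> \<beta> Lf r" unfolding eps2t_def
      using beta_pos r by (intro add_pos_nonneg) auto
    show "0 < eps4 \<beta>" by (simp add: eps4_def add_nonneg_pos)
    have "0 < 1 + 1 / r2 + \<alpha> / \<beta>" using r2 beta_pos alpha_gt by (simp add: add_pos_pos)
    thus "0 < eps6t \<alpha> \<beta> Lf r2" unfolding eps6t_def using A3(3) beta_pos
      by (intro add_pos_pos) auto
  qed
  have eta': "\<eta> * eps2t \<alpha> \<beta> Lf r < eps1t \<alpha> \<beta> Lf r2" "\<eta> * eps4 \<beta> < eps3 \<alpha> \<beta> r2"
    "\<eta> * eps6t \<alpha> \<beta> Lf r2 < eps5t \<alpha> \<beta> Lf r2"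
    using eta(2) pos unfolding r_def r2_def by (simp_all add: pos_less_divide_eq)
  interpret zeroth_order_primal_dual L B lam r r2 f g F gradF fstar Lf \<nu> \<alpha> \<beta> \<eta> x v \<delta>
  proof
    show "L $ i $ j = L $ j $ i" for i j unfolding L_def by (rule laplacian_sym[OF adj])
    show "(\<Sum>i\<in>UNIV. L $ i $ j) = 0" for j unfolding L_def by (rule laplacian_sum_zero[OF adj])
    show "\<nu> * (F z - fstar) \<le> (norm (gradF z))\<^sup>2 / 2" for z using A4(2)[rule_format, of z] by simp
  qed (use eb' r2 F_def gradF_def A2 A3 A4 beta_pos alpha_gt eta eta' delta v0 x_upd v_upd in
      \<open>auto intro: less_imp_le\<close>)
  define Y where "Y k = Knorm2 (x k)" for k
  have U0: "U0 = Y 0 + Knorm2 (w 0) + gap 0"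
    by (simp add: U0_def Y_def gap_def n_def w_def[abs_def] h0_def \<Delta>_def)
  have Y0: "0 \<le> Y k" "0 \<le> Knorm2 (w k)" "0 \<le> gap k" for k
    by (simp_all add: Y_def Knorm2_nonneg gap_nonneg)

  define a where "a = \<alpha> / \<beta>"
  define s where "s = 1 / r"
  have a: "a > 1" "\<alpha> = a * \<beta>" using beta_pos alpha_gt by (simp_all add: a_def)
  have s: "s > 0" "r = 1 / s" "s \<le> 1 / r2" using r r2 by (auto simp: s_def frac_le)
  have e8_eq: "e8 = (a + 1 + 1 / r2) / 2"
    using beta_pos by (simp add: e8_def eps8_def a_def field_simps)
  have e8: "e8 \<ge> (a + 1 + s) / 2" "1 \<le> e8" using s a by (simp_all add: e8_eq)
  have e9: "2 * e9 = min s ((a - 1) / a)"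
  proof -
    have "(\<alpha> - \<beta>) / (2 * \<alpha>) = (a - 1) / a / 2"
      using beta_pos alpha_gt by (simp add: a(2) field_simps)
    hence "e9 = min (s / 2) ((a - 1) / a / 2)" by (simp add: e9_def eps9_def s_def)
    moreover have "2 * min (s / 2) (m / 2) = min s m" for m :: real by (simp add: min_def)
    ultimately show ?thesis by (simp only:)
  qed
  have "0 < (a - 1) / a" using a by simp
  hence "0 < 2 * e9" unfolding e9 using s by simp
  hence e9_pos: "e9 > 0" by simp
  have u0: "0 \<le> u"
    using eta' eta(1) A4(1) by (simp add: u_def eps10t_def less_imp_le)
  \<comment> \<open>The second entry of the minimum in \<open>eps10t\<close> gives
    \<open>u \<le> \<eta> * \<beta>\<close>, and the step size condition with \<open>eps2t\<close>
    bounds \<eta>. After \<open>r2 \<le> r\<close> and multiplication by \<open>s * s\<close> only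
    \<open>a\<close> and \<open>s\<close> remain, as \<open>rate_slack\<close> requires.\<close>
  have u_le: "u \<le> (a - 1) * s / (s + 2 * a\<^sup>2 + 1)"
  proof -
    have "0 \<le> \<alpha> / (2 * \<beta>\<^sup>2) + 1 / (2 * \<beta> * r2)" using beta_pos alpha_gt r2 by simp
    hence "eps3 \<alpha> \<beta> r2 \<le> \<beta>" unfolding eps3_def by argo
    moreover have "0 \<le> \<eta> * eps4 \<beta>" using eta(1) pos(2) by simp
    ultimately have "u \<le> \<eta> * \<beta>" unfolding u_def eps10t_def
      using eta(1) by (intro mult_left_mono) auto
    also have "\<dots> \<le> (a - 1) * s / (s + 2 * a\<^sup>2 + 1)"
    proof -
      have "\<eta> * (\<beta>\<^sup>2 * r + (2 * \<alpha>\<^sup>2 + \<beta>\<^sup>2) * r\<^sup>2) \<le> \<eta> * eps2t \<alpha> \<beta> Lf r"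
        using eta(1) by (intro mult_left_mono) (auto simp: eps2t_def)
      also have "\<dots> \<le> eps1t \<alpha> \<beta> Lf r2" using eta'(1) by simp
      also have "\<dots> \<le> (\<alpha> - \<beta>) * r2" by (simp add: eps1t_def)
      also have "\<dots> \<le> (\<alpha> - \<beta>) * r" using r2 alpha_gt by (intro mult_left_mono) auto
      finally have "\<eta> * (\<beta>\<^sup>2 * r + (2 * \<alpha>\<^sup>2 + \<beta>\<^sup>2) * r\<^sup>2) * (s * s) \<le> (\<alpha> - \<beta>) * r * (s * s)"
        using s by (intro mult_right_mono) auto
      moreover have "\<eta> * (\<beta>\<^sup>2 * r + (2 * \<alpha>\<^sup>2 + \<beta>\<^sup>2) * r\<^sup>2) * (s * s)
          = \<eta> * (\<beta>\<^sup>2 * s * (r * s) + (2 * \<alpha>\<^sup>2 + \<beta>\<^sup>2) * (r * s)\<^sup>2)"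
        and "(\<alpha> - \<beta>) * r * (s * s) = (\<alpha> - \<beta>) * s * (r * s)"
        by (simp_all add: power2_eq_square algebra_simps)
      moreover have "r * s = 1" using s by simp
      ultimately have "\<eta> * (\<beta>\<^sup>2 * s + (2 * \<alpha>\<^sup>2 + \<beta>\<^sup>2)) \<le> (\<alpha> - \<beta>) * s" by simp
      hence "(\<eta> * \<beta> * (s + 2 * a\<^sup>2 + 1)) * \<beta> \<le> ((a - 1) * s) * \<beta>"
        by (simp add: a(2) power2_eq_square algebra_simps)
      hence "\<eta> * \<beta> * (s + 2 * a\<^sup>2 + 1) \<le> (a - 1) * s" using beta_pos by (rule mult_right_le_imp_le)
      moreover have "s + 2 * a\<^sup>2 + 1 > 0" using s by (simp add: add_pos_nonneg)
      ultimately show ?thesis by (simp add: pos_le_divide_eq)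
    qed
    finally show ?thesis .
  qed
  note slack = rate_slack[OF a(1) s(1) u0 u_le e8(1), folded et_def]
  have et: "0 < 1 - et"
  proof -
    have "1 / a < 1" using a by simp
    thus ?thesis using slack(2) by linarith
  qed
  \<comment> \<open>Weighting the optimality gap by \<open>\<theta>\<close> instead of 1 makes up for the distance bound
    \<open>2 / \<nu>\<close> from quadratic growth being worse than the factor \<open>1 / (2 \<nu>)\<close> in the claim.\<close>
  define \<theta> where "\<theta> = min 2 e8"
  have \<theta>: "1 \<le> \<theta>" "\<theta> \<le> 2" "\<theta> \<le> e8" using e8(2) by (auto simp: \<theta>_def)
  \<comment> \<open>The weight 2 alone would satisfy this bound, but \<open>V_le\<close> also needs
    \<open>\<theta> \<le> e8\<close>; hence the minimum, and one estimate for each of its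
    entries.\<close>
  have e9\<theta>: "4 * e9 \<le> (1 - et) * \<theta>"
  proof -
    define m where "m = (a - 1) / a"
    have "2 * e9 \<le> m" unfolding e9 m_def by simp
    moreover have "m \<le> 1 - et" using slack(2) a by (simp add: m_def diff_divide_distrib)
    moreover have "2 * m \<le> (1 - et) * e8" using slack(3) by (simp add: m_def)
    ultimately show ?thesis unfolding \<theta>_def min_def by auto
  qed
  define V where "V k = quad k + \<theta> * gap k" for k
  \<comment> \<open>The slack is spent here: with \<open>1 - et\<close> on the right, a bound on
    \<open>V k\<close> of order \<open>(1 - et) ^ k\<close> yields the exponent
    \<open>k + 1\<close>. The factor is dropped on \<open>phi\<close>, which is nonnegative.\<close>
  have quad_Y: "e9 * Y k \<le> (1 - et) * quad k" for k
  proof -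
    have "e9 * Y k \<le> (1 - et) * (1 - 1 / (s + a)) / 2 * Y k"
      using slack(1) Y0 unfolding e9[symmetric] by (intro mult_right_mono) auto
    also have "\<dots> = (1 - et) * ((1 - 1 / (1 / r + \<alpha> / \<beta>)) / 2 * Y k)" by (simp add: s_def a_def)
    also have "\<dots> \<le> (1 - et) * quad k"
      using et quad_lower[of k] unfolding Y_def by (intro mult_left_mono) auto
    finally show ?thesis .
  qed
  have V_le: "V k \<le> e8 * (Y k + Knorm2 (w k) + gap k)" for k
  proof -
    have "\<theta> * gap k \<le> e8 * gap k" using \<theta> Y0 by (intro mult_right_mono) auto
    thus ?thesis using quad_upper[of k] unfolding V_def Y_def e8_def by (simp add: distrib_left)
  qed
  have noise_pos: "0 \<le> e12" "0 \<le> e11"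
  proof -
    show "0 \<le> e12" unfolding e12_def eps12_def using eta(1) beta_pos alpha_gt r2
      by (intro mult_nonneg_nonneg add_nonneg_nonneg) (auto simp: n_def p_def)
    thus "0 \<le> e11" unfolding e11_def eps11_def using eta(1)
      by (simp add: e12_def n_def p_def)
  qed
  have \<Delta>2: "(\<Delta> k)\<^sup>2 \<le> eh ^ k" for k
  proof -
    have "\<Delta> k \<in> range (\<lambda>i. \<delta> i k)" unfolding \<Delta>_def by (rule Max_in) auto
    then obtain i where "\<Delta> k = \<delta> i k" by auto
    hence "\<Delta> k \<le> eh powr (real k / 2)" using delta by simp
    hence "(\<Delta> k)\<^sup>2 \<le> (eh powr (real k / 2))\<^sup>2" using \<Delta>(2)[of k] by (intro power_mono) auto
    also have "\<dots> = eh ^ k" using eh by (simp add: power2_eq_square powr_add[symmetric] powr_realpow)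
    finally show ?thesis .
  qed
  have V_step: "V (Suc k) \<le> (1 - et) * V k + e11 * eh ^ k + e12 * eh ^ Suc k" for k
  proof -
    have "V (Suc k) \<le> V k - u * (Y k + Knorm2 (w k) + gap k) + e11 * (\<Delta> k)\<^sup>2 + e12 * (\<Delta> (Suc k))\<^sup>2"
      using lyapunov_descent[OF \<theta>(1,2), of k]
      by (simp only: V_def Y_def u_def e11_def e12_def n_def p_def)
    moreover have "et * V k \<le> et * (e8 * (Y k + Knorm2 (w k) + gap k))"
      using u0 e8 V_le by (intro mult_left_mono) (auto simp: et_def)
    moreover have "et * (e8 * (Y k + Knorm2 (w k) + gap k)) = u * (Y k + Knorm2 (w k) + gap k)"
      using e8(2) by (simp add: et_def)
    moreover have "e11 * (\<Delta> k)\<^sup>2 \<le> e11 * eh ^ k" "e12 * (\<Delta> (Suc k))\<^sup>2 \<le> e12 * eh ^ Suc k"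
      using noise_pos by (intro mult_left_mono \<Delta>2; simp)+
    ultimately show ?thesis unfolding left_diff_distrib by linarith
  qed
  note decay = perturbed_geometric_decay[OF V_step et eh(1) eb(1) noise_pos(2,1)]
  have bound: "(1 - et) * V k \<le> bound k" for k
  proof -
    have "(1 - et) ^ k * V 0 \<le> (1 - et) ^ k * (e8 * U0)"
      using et V_le[of 0] by (intro mult_left_mono) (auto simp: U0)
    hence "V k \<le> (1 - et) ^ k * (e8 * U0) + phi e11 e12 et eh eb k"
      using decay(1)[of k] by linarith
    hence "(1 - et) * V k \<le> (1 - et) * ((1 - et) ^ k * (e8 * U0) + phi e11 e12 et eh eb k)"
      using et by (intro mult_left_mono) auto
    also have "\<dots> = (1 - et) ^ (k + 1) * e8 * U0 + (1 - et) * phi e11 e12 et eh eb k"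
      by (simp add: algebra_simps)
    also have "\<dots> \<le> bound k"
    proof -
      have "0 \<le> et" using u0 e8 by (simp add: et_def)
      hence "(1 - et) * phi e11 e12 et eh eb k \<le> 1 * phi e11 e12 et eh eb k"
        using decay(2) by (intro mult_right_mono) auto
      thus ?thesis by (simp add: bound_def)
    qed
    finally show ?thesis .
  qed
  have gap_part: "4 * e9 * gap k \<le> (1 - et) * (\<theta> * gap k)" for k
    using mult_right_mono[OF e9\<theta> Y0(3)[of k]] by (simp add: mult.assoc)
  have sum_e9: "e9 * (Y k + gap k) \<le> bound k" for k
  proof -
    have "e9 * gap k \<le> 4 * e9 * gap k" using e9_pos Y0(3)[of k] by simp
    thus ?thesis using quad_Y[of k] gap_part[of k] bound[of k] unfolding V_def distrib_left by linarith
  qed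
  have part1: "Y k + gap k \<le> (1 / e9) * bound k" for k
    using sum_e9[of k] e9_pos by (simp add: pos_le_divide_eq mult.commute)
  have part2: "(\<Sum>i\<in>UNIV. (norm (x k i - proj {z. F z = fstar} (avg (x k))))\<^sup>2)
      \<le> (1 / e9) * (1 + 1 / (2 * \<nu>)) * bound k"
    if ex1: "\<forall>z. \<exists>!y. is_proj {z. F z = fstar} z y" for k
  proof -
    define q where "q = proj {z. F z = fstar} (avg (x k))"
    have "is_proj {z. F z = fstar} (avg (x k)) q"
      unfolding q_def proj_def by (rule theI'[OF ex1[rule_format]])
    hence "\<nu> / 2 * (norm (avg (x k) - q))\<^sup>2 \<le> F (avg (x k)) - fstar"
      by (intro PL_quadratic_growth[OF F_deriv gradF_lipschitz A3(3) fstar_le PL A4(1)])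
    hence "n * (\<nu> / 2 * (norm (avg (x k) - q))\<^sup>2) \<le> gap k"
      unfolding gap_def n_def by (intro mult_left_mono) auto
    hence "n * (norm (avg (x k) - q))\<^sup>2 \<le> 2 / \<nu> * gap k" using A4(1) by (simp add: field_simps)
    hence "e9 * (n * (norm (avg (x k) - q))\<^sup>2) \<le> e9 * (2 / \<nu> * gap k)"
      using e9_pos by (intro mult_left_mono) auto
    also have "\<dots> = 1 / (2 * \<nu>) * (4 * e9 * gap k)" by simp
    also have "\<dots> \<le> 1 / (2 * \<nu>) * bound k"
    proof -
      have "0 \<le> e9 * Y k" using e9_pos Y0 by simp
      hence "4 * e9 * gap k \<le> bound k"
        using quad_Y[of k] gap_part[of k] bound[of k] unfolding V_def distrib_left by linarith
      thus ?thesis using A4(1) by (intro mult_left_mono) auto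
    qed
    finally have 1: "e9 * (n * (norm (avg (x k) - q))\<^sup>2) \<le> 1 / (2 * \<nu>) * bound k" .
    have "e9 * Y k \<le> bound k"
    proof -
      have "0 \<le> e9 * gap k" using e9_pos Y0 by simp
      thus ?thesis using sum_e9[of k] unfolding distrib_left by linarith
    qed
    hence "e9 * (Y k + n * (norm (avg (x k) - q))\<^sup>2) \<le> (1 + 1 / (2 * \<nu>)) * bound k"
      using 1 unfolding distrib_left distrib_right by linarith
    moreover have "(\<Sum>i\<in>UNIV. (norm (x k i - q))\<^sup>2) = Y k + n * (norm (avg (x k) - q))\<^sup>2"
      by (simp add: sum_norm_shift Y_def n_def)
    ultimately have "e9 * (\<Sum>i\<in>UNIV. (norm (x k i - q))\<^sup>2) \<le> (1 + 1 / (2 * \<nu>)) * bound k" by simp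
    hence "(\<Sum>i\<in>UNIV. (norm (x k i - q))\<^sup>2) \<le> (1 + 1 / (2 * \<nu>)) * bound k / e9"
      using e9_pos by (simp add: pos_le_divide_eq mult.commute)
    thus ?thesis unfolding q_def by simp
  qed
  show ?thesis
    unfolding Let_def n_def[symmetric] p_def[symmetric] r_def[symmetric] r2_def[symmetric]
      e8_def[symmetric] e9_def[symmetric] e11_def[symmetric] e12_def[symmetric] u_def[symmetric]
      et_def[symmetric] U0_def[symmetric] bound_def[symmetric]
    using part1 part2 by (simp add: Y_def Knorm2_def gap_def n_def)
qed

end
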